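(* Let $\mathcal{H}$ be a real Hilbert space and let $f,g\colon\mathcal{H}\to\left]-\infty,+\infty\right]$ be proper convex lower semicontinuous functions with $\operatorname{dom} g\subset\operatorname{dom} f$ and $f$ Gâteaux differentiable on $\operatorname{dom} g$. Let $(\langle\cdot\mid\cdot\rangle_k)_{k\in\mathbb{N}}$ be a sequence of scalar products on $\mathcal{H}$ with induced norms $\|\cdot\|_k$ and associated positive operators $W_k$, and suppose that there exist $0<\nu\le\mu$ such that $\nu\|\cdot\|^2\le\|\cdot\|_k^2\le\mu\|\cdot\|^2$ for every $k\in\mathbb{N}$. Set $\nu_k=\inf_{\|x\|=1}\langle x\mid W_kx\rangle$ and $\mu_k=\sup_{\|x\|=1}\langle x\mid W_kx\rangle$. Suppose that at least one of the following holds: - there exists a summable sequence $(\eta_k)_{k\in\mathbb{N}}$ in $[0,+\infty[$ such that $\|\cdot\|_{k+1}^2\le(1+\eta_k)\|\cdot\|_k^2$ for every $k\in\mathbb{N}$; - $\sum_{k\in\mathbb{N}}(\mu_k-\nu_k)<+\infty$. The algorithm (VM-FBS), the line searches LS1--LS4 and their constants $\delta,\theta,\bar\gamma,\bar\lambda$ are those defined in the context. (i) Suppose that $\nabla f$ is globally Lipschitz continuous on $\operatorname{dom}g$ with constant $L$ and that $(\gamma_k)_{k\in\mathbb{N}}$ and $(\lambda_k)_{k\in\mathbb{N}}$ are generated through algorithm (VM-FBS) using any of the line searches LS1--LS4. Then - for LS1, $\inf_{k}\gamma_k\ge\min\{\bar\gamma,\,2\delta\theta\nu/(L\sup_{k}\lambda_k)\}$;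 - for LS2 or LS3, $\inf_{k}\lambda_k\ge\min\{\bar\lambda,\,2\delta\theta\nu/(L\sup_{k}\gamma_k)\}$; - for LS4, $\inf_{k}\gamma_k\ge\min\{\bar\gamma,\,\delta\theta\nu/(L\sup_{k}\lambda_k)\}$. (ii) Suppose that $\operatorname{argmin}_{\mathcal{H}}(f+g)\ne\varnothing$ and that $\nabla f$ is Lipschitz continuous on any weakly compact subset of $\operatorname{dom}g$. Let $(\gamma_k)_{k\in\mathbb{N}}$ and $(\lambda_k)_{k\in\mathbb{N}}$ be defined according to algorithm (VM-FBS) using any of the line searches LS1--LS4. Then $\inf_{k\in\mathbb{N}}\gamma_k>0$ and $\inf_{k\in\mathbb{N}}\lambda_k>0$.
   Context: $\mathcal{H}$ has scalar product $\langle\cdot\mid\cdot\rangle$ and norm $\|\cdot\|$. A quotient with denominator $0$ (when $L=0$) is read as $+\infty$. A proper convex function $h$ is Gâteaux differentiable at $x\in\operatorname{dom}h$ if there is $u\in\mathcal{H}$ with $\lim_{t\to0}(h(x+td)-h(x))/t=\langle d\mid u\rangle$ for all $d\in\mathcal{H}$; then $\nabla h(x):=u$. It is Gâteaux differentiable on a set if it is so at each point of the set. The positive operator $W_k\colon\mathcal{H}\to\mathcal{H}$ associated with $\langle\cdot\mid\cdot\rangle_k$ satisfies $\langle x\mid y\rangle_k=\langle x\mid W_ky\rangle$. $\nabla^kf$ is the gradient with respect to $\langle\cdot\mid\cdot\rangle_k$, i.e. $\nabla^kf(x)=W_k^{-1}\nabla f(x)$. For $h$ proper convex lower semicontinuous,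 $\operatorname{prox}^k_h(x)=\operatorname{argmin}_{y\in\mathcal{H}}\big(h(y)+\tfrac12\|y-x\|_k^2\big)$. For $x\in\operatorname{dom}g$, $\gamma>0$, $\lambda\in\left]0,1\right]$ set $$J_k(x,\gamma,\lambda)=x+\lambda\big(\operatorname{prox}^k_{\gamma g}(x-\gamma\nabla^kf(x))-x\big).$$ Algorithm (VM-FBS): let $x_0\in\operatorname{dom}g$ and, for $k=0,1,\dots$, choose $\gamma_k>0$, set $y_k=\operatorname{prox}^k_{\gamma_kg}(x_k-\gamma_k\nabla^kf(x_k))$, choose $\lambda_k\in\left]0,1\right]$, and set $x_{k+1}=x_k+\lambda_k(y_k-x_k)$ (so $x_{k+1}=J_k(x_k,\gamma_k,\lambda_k)$). Line searches (in each, $\delta,\theta\in\left]0,1\right[$ are fixed constants): LS1: $(\lambda_k)$ is given in $\left]0,1\right]$ with $\inf_k\lambda_k>0$; $\bar\gamma>0$; for every $k$, $\gamma_k$ is the largest $\gamma\in\{\bar\gamma\theta^i: i\in\mathbb{N}\}$ (with $0\in\mathbb{N}$) such that $f(J_k(x_k,\gamma,\lambda_k))-f(x_k)-\langle J_k(x_k,\gamma,\lambda_k)-x_k\mid\nabla f(x_k)\rangle\le\frac{\delta}{\gamma\lambda_k}\|J_k(x_k,\gamma,\lambda_k)-x_k\|_k^2$. LS2: $(\gamma_k)$ is given with $0<\inf_k\gamma_k\le\sup_k\gamma_k<+\infty$; $\bar\lambda\in\left]0,1\right]$; for every $k$, $\lambda_k$ is the largest $\lambda\in\{\bar\lambda\theta^i:i\in\mathbb{N}\}$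 such that $f(J_k(x_k,\gamma_k,\lambda))-f(x_k)-\langle J_k(x_k,\gamma_k,\lambda)-x_k\mid\nabla f(x_k)\rangle\le\frac{\delta}{\gamma_k\lambda}\|J_k(x_k,\gamma_k,\lambda)-x_k\|_k^2$. LS3: $(\gamma_k)$ is given with $0<\inf_k\gamma_k\le\sup_k\gamma_k<+\infty$; $\bar\lambda\in\left]0,1\right]$; for every $k$, $\lambda_k$ is the largest $\lambda\in\{\bar\lambda\theta^i:i\in\mathbb{N}\}$ such that $(f+g)(J_k(x_k,\gamma_k,\lambda))-(f+g)(x_k)\le(1-\delta)\lambda\big(g(y_k)-g(x_k)+\langle y_k-x_k\mid\nabla f(x_k)\rangle\big)$. LS4: $(\lambda_k)$ is given in $\left]0,1\right]$ with $\inf_k\lambda_k>0$; $\bar\gamma>0$; for every $k$, $\gamma_k$ is the largest $\gamma\in\{\bar\gamma\theta^i:i\in\mathbb{N}\}$ such that $\|\nabla^kf(J_k(x_k,\gamma,\lambda_k))-\nabla^kf(x_k)\|_k\le\frac{\delta}{\gamma\lambda_k}\|J_k(x_k,\gamma,\lambda_k)-x_k\|_k$. *)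

theory Defs
  imports "HOL-Analysis.Analysis"
begin

text \<open>Functions into \<open>]-\<infinity>, +\<infinity>]\<close> are \<open>ereal\<close>-valued functions that never take the value
  \<open>-\<infinity>\<close>; this is part of \<open>proper\<close>.\<close>

definition edom :: "('a \<Rightarrow> ereal) \<Rightarrow> 'a set" where
  "edom h = {x. h x < \<infinity>}"

definition proper :: "('a \<Rightarrow> ereal) \<Rightarrow> bool" where
  "proper h \<longleftrightarrow> (\<forall>x. h x \<noteq> -\<infinity>) \<and> edom h \<noteq> {}"

definition ext_convex :: "('a::real_vector \<Rightarrow> ereal) \<Rightarrow> bool" where
  "ext_convex h \<longleftrightarrow> (\<forall>x y t. 0 < t \<and> t < 1 \<longrightarrow>
     h ((1 - t) *\<^sub>R x + t *\<^sub>R y) \<le> ereal (1 - t) * h x + ereal t * h y)"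

definition lsc :: "('a::topological_space \<Rightarrow> ereal) \<Rightarrow> bool" where
  "lsc h \<longleftrightarrow> (\<forall>x. h x \<le> Liminf (at x) h)"

text \<open>The quotient is taken in \<open>ereal\<close>, since \<open>h (x + t *\<^sub>R d)\<close> may be \<open>+\<infinity>\<close>.\<close>

definition has_gateaux_gradient :: "('a::real_inner \<Rightarrow> ereal) \<Rightarrow> 'a \<Rightarrow> 'a \<Rightarrow> bool" where
  "has_gateaux_gradient h x u \<longleftrightarrow> x \<in> edom h \<and>
     (\<forall>d. ((\<lambda>t. (h (x + t *\<^sub>R d) - h x) / ereal t) \<longlongrightarrow> ereal (inner d u)) (at 0))"

definition gateaux_differentiable_on :: "('a::real_inner \<Rightarrow> ereal) \<Rightarrow> 'a set \<Rightarrow> bool" where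
  "gateaux_differentiable_on h A \<longleftrightarrow> (\<forall>x\<in>A. \<exists>u. has_gateaux_gradient h x u)"

definition gateaux_gradient :: "('a::real_inner \<Rightarrow> ereal) \<Rightarrow> 'a \<Rightarrow> 'a" where
  "gateaux_gradient h x = (THE u. has_gateaux_gradient h x u)"

definition is_scalar_product :: "('a::real_vector \<Rightarrow> 'a \<Rightarrow> real) \<Rightarrow> bool" where
  "is_scalar_product S \<longleftrightarrow> bilinear S \<and> (\<forall>x y. S x y = S y x) \<and> (\<forall>x. x \<noteq> 0 \<longrightarrow> 0 < S x x)"

definition sp_norm :: "('a \<Rightarrow> 'a \<Rightarrow> real) \<Rightarrow> 'a \<Rightarrow> real" where
  "sp_norm S x = sqrt (S x x)"

text \<open>For a scalar product \<open>S\<close> on a Hilbert space whose norm is equivalent to the ambient one,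
  such a \<open>W\<close> exists, is unique and bijective, and is a positive bounded linear operator.\<close>

definition associated_operator ::
    "('a::real_inner \<Rightarrow> 'a \<Rightarrow> real) \<Rightarrow> ('a \<Rightarrow> 'a) \<Rightarrow> bool" where
  "associated_operator S W \<longleftrightarrow> (\<forall>x y. S x y = inner x (W y))"

definition metric_gradient :: "('a \<Rightarrow> 'a) \<Rightarrow> ('a::real_inner \<Rightarrow> ereal) \<Rightarrow> 'a \<Rightarrow> 'a" where
  "metric_gradient W h x = inv W (gateaux_gradient h x)"

definition prox :: "('a::real_vector \<Rightarrow> 'a \<Rightarrow> real) \<Rightarrow> ('a \<Rightarrow> ereal) \<Rightarrow> 'a \<Rightarrow> 'a" where
  "prox S h x = arg_min (\<lambda>y. h y + ereal ((sp_norm S (y - x))\<^sup>2 / 2)) (\<lambda>_. True)"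

definition fb_point ::
    "('a::real_inner \<Rightarrow> ereal) \<Rightarrow> ('a \<Rightarrow> ereal) \<Rightarrow> ('a \<Rightarrow> 'a \<Rightarrow> real) \<Rightarrow> ('a \<Rightarrow> 'a)
      \<Rightarrow> 'a \<Rightarrow> real \<Rightarrow> 'a" where
  "fb_point f g S W x \<gamma> =
     prox S (\<lambda>z. ereal \<gamma> * g z) (x - \<gamma> *\<^sub>R metric_gradient W f x)"

definition fb_step ::
    "('a::real_inner \<Rightarrow> ereal) \<Rightarrow> ('a \<Rightarrow> ereal) \<Rightarrow> ('a \<Rightarrow> 'a \<Rightarrow> real) \<Rightarrow> ('a \<Rightarrow> 'a)
      \<Rightarrow> 'a \<Rightarrow> real \<Rightarrow> real \<Rightarrow> 'a" where
  "fb_step f g S W x \<gamma> lam = x + lam *\<^sub>R (fb_point f g S W x \<gamma> - x)"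

definition vm_fbs ::
    "('a::real_inner \<Rightarrow> ereal) \<Rightarrow> ('a \<Rightarrow> ereal) \<Rightarrow> (nat \<Rightarrow> 'a \<Rightarrow> 'a \<Rightarrow> real) \<Rightarrow> (nat \<Rightarrow> 'a \<Rightarrow> 'a)
      \<Rightarrow> (nat \<Rightarrow> 'a) \<Rightarrow> (nat \<Rightarrow> 'a) \<Rightarrow> (nat \<Rightarrow> real) \<Rightarrow> (nat \<Rightarrow> real) \<Rightarrow> bool" where
  "vm_fbs f g S W x y \<gamma> lam \<longleftrightarrow> x 0 \<in> edom g \<and>
     (\<forall>k. 0 < \<gamma> k \<and> 0 < lam k \<and> lam k \<le> 1 \<and>
        y k = fb_point f g (S k) (W k) (x k) (\<gamma> k) \<and>
        x (Suc k) = x k + lam k *\<^sub>R (y k - x k))"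

text \<open>The infima and suprema of step sizes and relaxation parameters are formed in \<open>ereal\<close>, so
  that they are meaningful without boundedness assumptions.\<close>

definition LS1 ::
    "('a::real_inner \<Rightarrow> ereal) \<Rightarrow> ('a \<Rightarrow> ereal) \<Rightarrow> (nat \<Rightarrow> 'a \<Rightarrow> 'a \<Rightarrow> real) \<Rightarrow> (nat \<Rightarrow> 'a \<Rightarrow> 'a)
      \<Rightarrow> real \<Rightarrow> real \<Rightarrow> real \<Rightarrow> (nat \<Rightarrow> 'a) \<Rightarrow> (nat \<Rightarrow> real) \<Rightarrow> (nat \<Rightarrow> real) \<Rightarrow> bool" where
  "LS1 f g S W \<delta> \<theta> gambar x \<gamma> lam \<longleftrightarrow>
     0 < (INF k. ereal (lam k)) \<and> 0 < gambar \<and>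
     (\<forall>k. is_arg_max (\<lambda>c. c)
        (\<lambda>c. c \<in> {gambar * \<theta> ^ i | i. True} \<and>
           (let J = fb_step f g (S k) (W k) (x k) c (lam k) in
              f J - f (x k) - ereal (inner (J - x k) (gateaux_gradient f (x k)))
                \<le> ereal (\<delta> / (c * lam k) * (sp_norm (S k) (J - x k))\<^sup>2)))
        (\<gamma> k))"

definition LS2 ::
    "('a::real_inner \<Rightarrow> ereal) \<Rightarrow> ('a \<Rightarrow> ereal) \<Rightarrow> (nat \<Rightarrow> 'a \<Rightarrow> 'a \<Rightarrow> real) \<Rightarrow> (nat \<Rightarrow> 'a \<Rightarrow> 'a)
      \<Rightarrow> real \<Rightarrow> real \<Rightarrow> real \<Rightarrow> (nat \<Rightarrow> 'a) \<Rightarrow> (nat \<Rightarrow> real) \<Rightarrow> (nat \<Rightarrow> real) \<Rightarrow> bool" where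
  "LS2 f g S W \<delta> \<theta> lambar x \<gamma> lam \<longleftrightarrow>
     0 < (INF k. ereal (\<gamma> k)) \<and> (SUP k. ereal (\<gamma> k)) < \<infinity> \<and> 0 < lambar \<and> lambar \<le> 1 \<and>
     (\<forall>k. is_arg_max (\<lambda>l. l)
        (\<lambda>l. l \<in> {lambar * \<theta> ^ i | i. True} \<and>
           (let J = fb_step f g (S k) (W k) (x k) (\<gamma> k) l in
              f J - f (x k) - ereal (inner (J - x k) (gateaux_gradient f (x k)))
                \<le> ereal (\<delta> / (\<gamma> k * l) * (sp_norm (S k) (J - x k))\<^sup>2)))
        (lam k))"

definition LS3 ::
    "('a::real_inner \<Rightarrow> ereal) \<Rightarrow> ('a \<Rightarrow> ereal) \<Rightarrow> (nat \<Rightarrow> 'a \<Rightarrow> 'a \<Rightarrow> real) \<Rightarrow> (nat \<Rightarrow> 'a \<Rightarrow> 'a)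
      \<Rightarrow> real \<Rightarrow> real \<Rightarrow> real \<Rightarrow> (nat \<Rightarrow> 'a) \<Rightarrow> (nat \<Rightarrow> 'a) \<Rightarrow> (nat \<Rightarrow> real) \<Rightarrow> (nat \<Rightarrow> real)
      \<Rightarrow> bool" where
  "LS3 f g S W \<delta> \<theta> lambar x y \<gamma> lam \<longleftrightarrow>
     0 < (INF k. ereal (\<gamma> k)) \<and> (SUP k. ereal (\<gamma> k)) < \<infinity> \<and> 0 < lambar \<and> lambar \<le> 1 \<and>
     (\<forall>k. is_arg_max (\<lambda>l. l)
        (\<lambda>l. l \<in> {lambar * \<theta> ^ i | i. True} \<and>
           (let J = fb_step f g (S k) (W k) (x k) (\<gamma> k) l in
              (f J + g J) - (f (x k) + g (x k))
                \<le> ereal ((1 - \<delta>) * l) *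
                    (g (y k) - g (x k)
                      + ereal (inner (y k - x k) (gateaux_gradient f (x k))))))
        (lam k))"

definition LS4 ::
    "('a::real_inner \<Rightarrow> ereal) \<Rightarrow> ('a \<Rightarrow> ereal) \<Rightarrow> (nat \<Rightarrow> 'a \<Rightarrow> 'a \<Rightarrow> real) \<Rightarrow> (nat \<Rightarrow> 'a \<Rightarrow> 'a)
      \<Rightarrow> real \<Rightarrow> real \<Rightarrow> real \<Rightarrow> (nat \<Rightarrow> 'a) \<Rightarrow> (nat \<Rightarrow> real) \<Rightarrow> (nat \<Rightarrow> real) \<Rightarrow> bool" where
  "LS4 f g S W \<delta> \<theta> gambar x \<gamma> lam \<longleftrightarrow>
     0 < (INF k. ereal (lam k)) \<and> 0 < gambar \<and>
     (\<forall>k. is_arg_max (\<lambda>c. c)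
        (\<lambda>c. c \<in> {gambar * \<theta> ^ i | i. True} \<and>
           (let J = fb_step f g (S k) (W k) (x k) c (lam k) in
              sp_norm (S k) (metric_gradient (W k) f J - metric_gradient (W k) f (x k))
                \<le> \<delta> / (c * lam k) * sp_norm (S k) (J - x k)))
        (\<gamma> k))"

text \<open>The coarsest topology for which all functionals \<open>\<lambda>x. inner x u\<close> are continuous.\<close>

definition weak_topology :: "'a::real_inner topology" where
  "weak_topology = topology_generated_by {{x. inner x u \<in> U} | u U. open U}"

end

theory Submission
  imports Defs
begin

text \<open>A rejected trial parameter violates its acceptance test, whereas on a convex set where \<open>\<nabla>f\<close> is
  Lipschitz the descent lemma makes every test hold for small parameters. Comparing the two bounds the
  last rejected parameter, hence the accepted one, from below. In (i) the convex set is \<open>dom g\<close>.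

  In (ii) such a set has to be found. Each acceptance test implies the one of LS3, which makes
  \<open>f + g\<close> decrease along the iterates and makes the iterates quasi-Fejer monotone with respect to a
  minimizer, so they stay in a bounded sublevel set of \<open>g\<close>. Such a set is weakly compact, hence
  \<open>\<nabla>f\<close> is bounded along the iterates, and therefore all trial points stay in a larger bounded
  sublevel set of \<open>g\<close>, on which \<open>\<nabla>f\<close> is again Lipschitz.\<close>

section \<open>Proximal minimization in an equivalent metric\<close>

text \<open>The prox point is an \<open>arg_min\<close> and the metric gradient an
  \<open>inv W\<close>, so neither has any property until minimizers exist and \<open>W\<close> is
  onto. One existence result serves both and, for the ambient scalar product, also gives the nearest
  points behind weak compactness.

  In (ii) the Lipschitz set must also contain points reached with rejected parameters, which the run
  never visits. They are bounded uniformly over all prox parameters up to a fixed bound: the prox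
  inequality sets a quadratic term in the displacement against an affine one. Sublevel sets of
  \<open>g\<close> enter because \<open>dom g\<close> need not be closed, so its bounded parts need
  not be weakly compact. Along the iterates \<open>g\<close> is bounded by the decrease of
  \<open>f + g\<close> together with the affine minorant of \<open>f\<close> at \<open>x 0\<close>.

  In the bounds, \<open>\<theta>\<close> appears because the estimate is made at the accepted
  parameter divided by \<open>\<theta>\<close>. The factor 2 is the 1/2 of the descent lemma; it is
  absent for LS4, whose test compares gradients directly.\<close>

lemma lsc_closed_sublevel:
  assumes "lsc h"
  shows "closed {x. h x \<le> c}"
proof -
  have "open {x. c < h x}"
  proof (rule open_subopen[THEN iffD2], rule ballI)
    fix x assume "x \<in> {x. c < h x}"
    then have "c < Liminf (at x) h"
      using assms by (auto simp: lsc_def intro: less_le_trans)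
    then have "eventually (\<lambda>y. c < h y) (at x)" by (rule less_LiminfD)
    \<comment> \<open>The filter \<open>at x\<close> leaves out \<open>x\<close> itself, where the
      inequality is the assumption.\<close>
    then have "eventually (\<lambda>y. c < h y) (nhds x)"
      using \<open>x \<in> _\<close> by (auto simp: eventually_at_filter elim: eventually_mono)
    then show "\<exists>T. open T \<and> x \<in> T \<and> T \<subseteq> {x. c < h x}"
      by (auto simp: eventually_nhds)
  qed
  moreover have "- {x. h x \<le> c} = {x. c < h x}" by auto
  ultimately show ?thesis by (simp add: closed_def)
qed

lemma proper_real:
  assumes "proper h" "x \<in> edom h"
  shows "h x = ereal (real_of_ereal (h x))"
  using assms by (cases "h x") (auto simp: proper_def edom_def)

text \<open>\<open>ext_convex\<close> speaks of \<open>0 < t < 1\<close> only; the endpoints are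
  added here so that whole segments can be used.\<close>

lemma convex_on_real:
  assumes "proper h" "ext_convex h" "x \<in> edom h" "y \<in> edom h" "0 \<le> t" "t \<le> 1"
  shows "(1 - t) *\<^sub>R x + t *\<^sub>R y \<in> edom h"
    and "real_of_ereal (h ((1 - t) *\<^sub>R x + t *\<^sub>R y))
      \<le> (1 - t) * real_of_ereal (h x) + t * real_of_ereal (h y)"
proof -
  let ?w = "(1 - t) *\<^sub>R x + t *\<^sub>R y"
  have "?w \<in> edom h \<and> real_of_ereal (h ?w) \<le> (1 - t) * real_of_ereal (h x) + t * real_of_ereal (h y)"
  proof (cases "t = 0 \<or> t = 1")
    case True
    then show ?thesis using assms by auto
  next
    case False
    then have "h ?w \<le> ereal (1 - t) * h x + ereal t * h y"
      using assms by (auto simp: ext_convex_def)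
    also have "\<dots> = ereal ((1 - t) * real_of_ereal (h x) + t * real_of_ereal (h y))"
      using proper_real[OF assms(1,3)] proper_real[OF assms(1,4)]
      by (metis plus_ereal.simps(1) times_ereal.simps(1))
    finally have *: "h ?w \<le> ereal ((1 - t) * real_of_ereal (h x) + t * real_of_ereal (h y))" .
    then have "?w \<in> edom h" by (auto simp: edom_def intro: le_less_trans)
    with * proper_real[OF assms(1) this] show ?thesis by (metis ereal_less_eq(3))
  qed
  then show "?w \<in> edom h" "real_of_ereal (h ?w) \<le> (1 - t) * real_of_ereal (h x) + t * real_of_ereal (h y)"
    by auto
qed

text \<open>Lower semicontinuity bounds \<open>h\<close> below near a point of its domain; convexity propagates this
  along rays with at most linear decay.\<close>

lemma proper_convex_lsc_minorant:
  fixes h :: "'a::real_normed_vector \<Rightarrow> ereal"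
  assumes h: "proper h" "ext_convex h" and cl: "\<And>c. closed {x. h x \<le> ereal c}"
  shows "\<exists>a b. 0 \<le> b \<and> (\<forall>z\<in>edom h. a - b * norm z \<le> real_of_ereal (h z))"
proof -
  obtain x0 where x0: "x0 \<in> edom h" using h by (auto simp: proper_def)
  \<comment> \<open>Any level strictly below \<open>h x0\<close> would do; the gap 1 becomes the
    numerator of the slope.\<close>
  define c where "c = real_of_ereal (h x0) - 1"
  have "x0 \<in> - {x. h x \<le> ereal c}"
    using proper_real[OF h(1) x0] unfolding c_def by (cases "h x0") auto
  moreover have "open (- {x. h x \<le> ereal c})" using cl by blast
  ultimately obtain r where r: "0 < r" "ball x0 r \<subseteq> - {x. h x \<le> ereal c}"
    by (meson openE)
  have near: "c < real_of_ereal (h z)" if "z \<in> ball x0 r" "z \<in> edom h" for z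
    using r that proper_real[OF h(1) that(2)] by (cases "h z") auto
  have main: "c - 2 / r * norm (z - x0) \<le> real_of_ereal (h z)" if z: "z \<in> edom h" for z
  proof (cases "norm (z - x0) < r")
    case True
    then have "c < real_of_ereal (h z)" using z by (intro near) (auto simp: dist_norm norm_minus_commute)
    moreover have "0 \<le> 2 / r * norm (z - x0)" using r by simp
    ultimately show ?thesis by linarith
  next
    case False
    define s where "s = norm (z - x0)"
    \<comment> \<open>Chosen so that the point at parameter \<open>t\<close> on the segment lies at
      distance \<open>r / 2\<close> from \<open>x0\<close>, inside the ball.\<close>
    define t where "t = r / (2 * s)"
    have s: "0 < s" "r \<le> s" using False r by (auto simp: s_def)
    then have t: "0 < t" "t \<le> 1" using r by (auto simp: t_def divide_simps)
    let ?w = "(1 - t) *\<^sub>R x0 + t *\<^sub>R z"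
    have "norm (?w - x0) = norm (t *\<^sub>R (z - x0))" by (simp add: algebra_simps)
    also have "\<dots> = r / 2" using t(1) s(1) r(1) by (simp add: t_def s_def[symmetric])
    finally have "?w \<in> ball x0 r" using r by (simp add: dist_norm norm_minus_commute)
    then have "c < (1 - t) * real_of_ereal (h x0) + t * real_of_ereal (h z)"
      using near convex_on_real[OF h x0 z, of t] t by force
    then have "- 1 < t * (real_of_ereal (h z) - real_of_ereal (h x0))"
      by (simp add: c_def algebra_simps)
    then have "- 1 / t < real_of_ereal (h z) - real_of_ereal (h x0)"
      using t by (simp add: divide_simps mult.commute)
    moreover have "1 / t = 2 / r * s" using r s by (simp add: t_def)
    ultimately show ?thesis by (simp add: c_def s_def)
  qed
  show ?thesis
  proof (intro exI conjI ballI)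
    show "0 \<le> 2 / r" using r by simp
    fix z assume z: "z \<in> edom h"
    have "2 / r * norm (z - x0) \<le> 2 / r * (norm z + norm x0)"
      using r by (intro mult_left_mono norm_triangle_ineq4) auto
    then show "(c - 2 / r * norm x0) - 2 / r * norm z \<le> real_of_ereal (h z)"
      using main[OF z] by (simp add: distrib_left)
  qed
qed

text \<open>Not tied to the algorithm: besides each \<open>S k\<close>, the ambient
  \<open>inner\<close> with the identity as operator is an instance.\<close>

locale scalar_metric =
  fixes S :: "'a::{real_inner,complete_space} \<Rightarrow> 'a \<Rightarrow> real" and W :: "'a \<Rightarrow> 'a" and \<nu> \<mu> :: real
  assumes scalar_product: "is_scalar_product S"
    and operator: "associated_operator S W"
    and pos: "0 < \<nu>"
    and lower: "\<nu> * (norm z)\<^sup>2 \<le> S z z"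
    and upper: "S z z \<le> \<mu> * (norm z)\<^sup>2"
begin

lemma commute: "S x y = S y x"
  using scalar_product by (auto simp: is_scalar_product_def)

lemma
  shows add_left: "S (x + y) z = S x z + S y z" and add_right: "S z (x + y) = S z x + S z y"
    and scale_left: "S (c *\<^sub>R x) z = c * S x z" and scale_right: "S z (c *\<^sub>R x) = c * S z x"
    and diff_left: "S (x - y) z = S x z - S y z" and diff_right: "S z (x - y) = S z x - S z y"
  using scalar_product
  by (simp_all add: is_scalar_product_def bilinear_ladd bilinear_radd bilinear_lmul bilinear_rmul
      bilinear_lsub bilinear_rsub)

lemma minus_left: "S (- x) z = - S x z"
  using scale_left[of "- 1" x z] by simp

lemma minus_right: "S z (- x) = - S z x"
  using scale_right[of z "- 1" x] by simp

lemmas expand = add_left add_right scale_left scale_right diff_left diff_right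

lemma eq_inner: "S x y = inner x (W y)"
  using operator by (simp add: associated_operator_def)

lemma nonneg: "0 \<le> S z z"
  by (rule order_trans[OF _ lower]) (simp add: pos less_imp_le)

lemma sp_norm_sq: "(sp_norm S z)\<^sup>2 = S z z"
  by (simp add: sp_norm_def nonneg)

text \<open>The parallelogram law makes every minimizing sequence Cauchy.\<close>

lemma minimizer_exists:
  fixes h :: "'a \<Rightarrow> ereal" and v :: 'a
  assumes h: "proper h" "ext_convex h" and cl: "\<And>c. closed {x. h x \<le> ereal c}"
  shows "\<exists>p. is_arg_min (\<lambda>y. h y + ereal (S (y - v) (y - v) / 2)) (\<lambda>_. True) p"
proof -
  define q where "q y = S (y - v) (y - v) / 2" for y
  define r where "r y = real_of_ereal (h y)" for y
  have r: "h y = ereal (r y)" if "y \<in> edom h" for y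
    using proper_real[OF h(1) that] by (simp add: r_def)
  obtain a b where ab: "0 \<le> b" "\<And>z. z \<in> edom h \<Longrightarrow> a - b * norm z \<le> r z"
    using proper_convex_lsc_minorant[OF h cl] unfolding r_def by blast
  obtain x0 where x0: "x0 \<in> edom h" using h by (auto simp: proper_def)
  \<comment> \<open>The quadratic term beats the linear decay of the minorant: complete the square
    in \<open>\<nu> * s - b\<close>.\<close>
  have below: "a - b * norm v - b\<^sup>2 / (2 * \<nu>) \<le> r z + q z" if z: "z \<in> edom h" for z
  proof -
    define s where "s = norm (z - v)"
    have "norm z \<le> s + norm v" unfolding s_def by norm
    then have "b * norm z \<le> b * (s + norm v)" using ab by (intro mult_left_mono)
    then have "a - b * norm v - b * s \<le> r z" using ab(2)[OF z] by (simp add: distrib_left)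
    moreover have "\<nu> * s\<^sup>2 \<le> 2 * q z" using lower[of "z - v"] by (simp add: q_def s_def)
    moreover have "0 \<le> (\<nu> * s - b)\<^sup>2 / (2 * \<nu>)" using pos by simp
    then have "b * s \<le> \<nu> * s\<^sup>2 / 2 + b\<^sup>2 / (2 * \<nu>)"
      using pos by (simp add: power2_eq_square field_simps)
    ultimately show ?thesis by linarith
  qed
  define m where "m = (INF z\<in>edom h. r z + q z)"
  have bdd: "bdd_below ((\<lambda>z. r z + q z) ` edom h)" using below by (rule bdd_belowI2)
  have m_le: "m \<le> r z + q z" if "z \<in> edom h" for z
    unfolding m_def using bdd that by (rule cINF_lower)
  have "\<exists>z\<in>edom h. r z + q z < m + inverse (real (Suc n))" for n
  proof (rule ccontr)
    assume "\<not> ?thesis"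
    then have "m + inverse (real (Suc n)) \<le> m"
      using x0 unfolding m_def by (intro cINF_greatest) (auto simp: not_less)
    then show False by simp
  qed
  then obtain z where z: "\<And>n. z n \<in> edom h" "\<And>n. r (z n) + q (z n) < m + inverse (real (Suc n))"
    by metis
  have gap: "\<nu> / 4 * (norm (z i - z j))\<^sup>2 \<le> inverse (real (Suc i)) + inverse (real (Suc j))" for i j
  proof -
    define w where "w = (1/2) *\<^sub>R z i + (1/2) *\<^sub>R z j"
    have w: "w \<in> edom h" "r w \<le> (r (z i) + r (z j)) / 2"
      using convex_on_real[OF h z(1)[of i] z(1)[of j], of "1/2"] by (auto simp: r_def w_def)
    define A where "A = z i - v"
    define B where "B = z j - v"
    have "w - v = (1/2) *\<^sub>R (A + B)" and AB: "z i - z j = A - B"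
      by (simp_all add: w_def A_def B_def algebra_simps flip: scaleR_add_left)
    then have "8 * q w = S (A + B) (A + B)"
      by (simp add: q_def scale_left scale_right)
    then have "4 * q w = 2 * q (z i) + 2 * q (z j) - S (z i - z j) (z i - z j) / 2"
      unfolding AB q_def A_def[symmetric] B_def[symmetric] using commute[of A B]
      by (simp add: expand field_simps)
    then have "S (z i - z j) (z i - z j) / 4 \<le> (r (z i) + q (z i) - m) + (r (z j) + q (z j) - m)"
      using m_le[OF w(1)] w(2) by argo
    then show ?thesis using z(2)[of i] z(2)[of j] lower[of "z i - z j"] by linarith
  qed
  have "Cauchy z"
  proof (rule metric_CauchyI)
    fix e :: real assume e: "0 < e"
    then have "0 < \<nu> * e\<^sup>2 / 8" using pos by simp
    then obtain N where N: "inverse (real (Suc N)) < \<nu> * e\<^sup>2 / 8" using reals_Archimedean by blast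
    have "dist (z i) (z j) < e" if "N \<le> i" "N \<le> j" for i j
    proof -
      have "inverse (real (Suc i)) \<le> inverse (real (Suc N))" "inverse (real (Suc j)) \<le> inverse (real (Suc N))"
        using that by (auto intro!: le_imp_inverse_le)
      then have "\<nu> / 4 * (norm (z i - z j))\<^sup>2 < \<nu> / 4 * e\<^sup>2" using gap[of i j] N by linarith
      then have "(norm (z i - z j))\<^sup>2 < e\<^sup>2" using pos by simp
      then show ?thesis using e by (simp add: dist_norm power2_less_imp_less)
    qed
    then show "\<exists>N. \<forall>i\<ge>N. \<forall>j\<ge>N. dist (z i) (z j) < e" by blast
  qed
  then obtain p where p: "z \<longlonglongrightarrow> p" using Cauchy_convergent convergent_def by blast
  \<comment> \<open>Expanding \<open>q\<close> around \<open>p\<close> leaves a quadratic term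
    squeezed to 0 by \<open>upper\<close> and an ambient inner product with a fixed vector.\<close>
  have q_lim: "(\<lambda>n. q (z n)) \<longlonglongrightarrow> q p"
  proof -
    have d: "(\<lambda>n. z n - p) \<longlonglongrightarrow> 0" using p by (simp add: LIM_zero)
    have "(\<lambda>n. S (z n - p) (z n - p)) \<longlonglongrightarrow> 0"
    proof (rule tendsto_sandwich[OF always_eventually always_eventually tendsto_const])
      show "\<forall>n. 0 \<le> S (z n - p) (z n - p)" by (simp add: nonneg)
      show "\<forall>n. S (z n - p) (z n - p) \<le> \<mu> * (norm (z n - p))\<^sup>2" by (simp add: upper)
      show "(\<lambda>n. \<mu> * (norm (z n - p))\<^sup>2) \<longlonglongrightarrow> 0"
        using tendsto_mult_right_zero[OF tendsto_null_power[OF tendsto_norm_zero[OF d]], of 2] by simp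
    qed
    moreover have "(\<lambda>n. inner (z n - p) (W (p - v))) \<longlonglongrightarrow> 0"
      using tendsto_inner[OF d tendsto_const] by simp
    ultimately have "(\<lambda>n. S (z n - p) (z n - p) / 2 + inner (z n - p) (W (p - v)) + q p) \<longlonglongrightarrow> 0 / 2 + 0 + q p"
      by (intro tendsto_intros) simp_all
    moreover have "S (z n - p) (z n - p) / 2 + inner (z n - p) (W (p - v)) + q p = q (z n)" for n
      unfolding q_def eq_inner[symmetric]
      using commute[of "z n" p] commute[of "z n" v] commute[of p v]
      by (simp add: expand field_simps)
    ultimately show ?thesis by simp
  qed
  \<comment> \<open>A tail of \<open>z\<close> lies in the closed sublevel set at this level, hence
    so does its limit.\<close>
  have le: "h p \<le> ereal (m + e - q p)" if e: "0 < e" for e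
  proof -
    have "(\<lambda>n. inverse (real (Suc n)) - q (z n)) \<longlonglongrightarrow> 0 - q p"
      by (intro tendsto_diff q_lim LIMSEQ_inverse_real_of_nat)
    moreover have "0 - q p < e - q p" using e by simp
    ultimately have "eventually (\<lambda>n. inverse (real (Suc n)) - q (z n) < e - q p) sequentially"
      by (rule order_tendstoD)
    then have "eventually (\<lambda>n. z n \<in> {x. h x \<le> ereal (m + e - q p)}) sequentially"
    proof eventually_elim
      case (elim n)
      then show ?case using z(2)[of n] r[OF z(1)[of n]] by simp
    qed
    then have "p \<in> {x. h x \<le> ereal (m + e - q p)}"
      by (rule Lim_in_closed_set[OF cl _ sequentially_bot p])
    then show ?thesis by simp
  qed
  have "h p \<le> ereal (m + 1 - q p)" using le[of 1] by simp
  then have pd: "p \<in> edom h" by (auto simp: edom_def intro: le_less_trans)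
  have "r p + q p \<le> m"
    by (rule field_le_epsilon) (use le r[OF pd] in fastforce)
  then have "h p + ereal (q p) \<le> h y + ereal (q y)" for y
    using m_le[of y] r[OF pd] r[of y] by (cases "y \<in> edom h") (auto simp: edom_def)
  then show ?thesis unfolding q_def by (auto simp: is_arg_min_linorder)
qed

text \<open>First-order optimality: compare \<open>p\<close> with \<open>p + t (z - p)\<close> and let \<open>t\<close> tend to \<open>0\<close>.\<close>

lemma minimizer_variational:
  fixes h :: "'a \<Rightarrow> ereal" and v :: 'a
  assumes h: "proper h" "ext_convex h"
    and p: "is_arg_min (\<lambda>y. h y + ereal (S (y - v) (y - v) / 2)) (\<lambda>_. True) p"
  shows "p \<in> edom h"
    and "z \<in> edom h \<Longrightarrow> S (v - p) (z - p) \<le> real_of_ereal (h z) - real_of_ereal (h p)"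
proof -
  have min: "h p + ereal (S (p - v) (p - v) / 2) \<le> h y + ereal (S (y - v) (y - v) / 2)" for y
    using p by (auto simp: is_arg_min_linorder)
  obtain x0 where x0: "x0 \<in> edom h" using h by (auto simp: proper_def)
  show pd: "p \<in> edom h"
    using min[of x0] x0 by (cases "h x0"; cases "h p") (auto simp: edom_def)
  assume z: "z \<in> edom h"
  define D where "D = real_of_ereal (h z) - real_of_ereal (h p) - S (v - p) (z - p)"
  have step: "0 \<le> D + t * (S (z - p) (z - p) / 2)" if t: "0 < t" "t \<le> 1" for t
  proof -
    let ?w = "(1 - t) *\<^sub>R p + t *\<^sub>R z"
    have w: "?w \<in> edom h"
      "real_of_ereal (h ?w) \<le> (1 - t) * real_of_ereal (h p) + t * real_of_ereal (h z)"
      using convex_on_real[OF h pd z] t by auto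
    have "real_of_ereal (h p) + S (p - v) (p - v) / 2 \<le> real_of_ereal (h ?w) + S (?w - v) (?w - v) / 2"
      using min[of ?w] proper_real[OF h(1) pd] proper_real[OF h(1) w(1)]
      by (metis ereal_less_eq(3) plus_ereal.simps(1))
    moreover have "S (?w - v) (?w - v) = S ((p - v) + t *\<^sub>R (z - p)) ((p - v) + t *\<^sub>R (z - p))"
      by (simp add: algebra_simps)
    moreover have "\<dots> = S (p - v) (p - v) - 2 * t * S (v - p) (z - p) + t * t * S (z - p) (z - p)"
      using commute[of p v] commute[of p z] commute[of z v]
      by (simp add: expand algebra_simps)
    ultimately have "0 \<le> t * (D + t * (S (z - p) (z - p) / 2))"
      using w(2) by (simp add: D_def algebra_simps)
    then show ?thesis using t by (simp add: zero_le_mult_iff)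
  qed
  have "((\<lambda>t. D + t * (S (z - p) (z - p) / 2)) \<longlongrightarrow> D + 0 * (S (z - p) (z - p) / 2)) (at_right 0)"
    by (intro tendsto_intros)
  moreover have "eventually (\<lambda>t. 0 \<le> D + t * (S (z - p) (z - p) / 2)) (at_right 0)"
    using step by (auto simp: eventually_at_right_field intro!: exI[of _ 1])
  ultimately have "0 \<le> D + 0 * (S (z - p) (z - p) / 2)" by (intro tendsto_lowerbound) auto
  then show "S (v - p) (z - p) \<le> real_of_ereal (h z) - real_of_ereal (h p)" by (simp add: D_def)
qed

text \<open>The Lax--Milgram argument: solutions of \<open>W p = u\<close> minimize \<open>S z z / 2 - inner z u\<close>.\<close>

lemma surj_operator: "surj W"
proof (unfold surj_def, rule allI)
  fix u :: 'a
  let ?h = "\<lambda>z. ereal (- inner z u)"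
  have h: "proper ?h" "ext_convex ?h"
    by (auto simp: proper_def edom_def ext_convex_def inner_add_left)
  have "closed {z. - inner z u \<le> c}" for c by (intro closed_Collect_le continuous_intros)
  then obtain p where p: "is_arg_min (\<lambda>y. ?h y + ereal (S (y - 0) (y - 0) / 2)) (\<lambda>_. True) p"
    using minimizer_exists[OF h, of 0] by auto
  have "S (0 - p) (z - p) \<le> - inner z u + inner p u" for z
    using minimizer_variational(2)[OF h p, of z] by (simp add: edom_def)
  \<comment> \<open>Moving from \<open>p\<close> along the residual \<open>u - W p\<close> turns the
    variational inequality into a bound on its squared norm.\<close>
  from this[of "p + (u - W p)"] have "inner (u - W p) u \<le> S p (u - W p)"
    by (simp add: expand minus_left inner_add_left inner_diff_left)
  also have "\<dots> = inner (u - W p) (W p)" by (metis commute eq_inner)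
  finally have "inner (u - W p) (u - W p) \<le> 0" by (simp add: inner_diff_right)
  then have "u - W p = 0" by (metis inner_ge_zero inner_eq_zero_iff order_antisym)
  then show "\<exists>x. u = W x" by auto
qed

end

section \<open>Weak compactness\<close>

text \<open>Projecting the origin onto \<open>C\<close> is the proximal problem at 0 for the
  indicator function of \<open>C\<close>; its variational inequality
  \<open>inner p (z - p) \<ge> 0\<close> yields the Pythagorean estimate.\<close>

lemma min_norm_point_exists:
  fixes C :: "'a::{real_inner,complete_space} set"
  assumes "closed C" "convex C" "C \<noteq> {}"
  shows "\<exists>p\<in>C. \<forall>z\<in>C. (norm (z - p))\<^sup>2 \<le> (norm z)\<^sup>2 - (norm p)\<^sup>2"
proof -
  interpret scalar_metric inner "\<lambda>x::'a. x" 1 1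
    by unfold_locales
      (auto simp: is_scalar_product_def associated_operator_def bilinear_def inner_commute
        power2_norm_eq_inner inner_add_left inner_add_right intro!: linearI)
  let ?h = "\<lambda>x. if x \<in> C then 0 else \<infinity> :: ereal"
  have dom: "edom ?h = C" by (auto simp: edom_def)
  have h: "proper ?h" using assms dom by (auto simp: proper_def)
  have cv: "ext_convex ?h"
    unfolding ext_convex_def using convexD_alt[OF assms(2)] by auto
  have "closed {x. ?h x \<le> ereal c}" for c
  proof (cases "0 \<le> c")
    case True
    then have "{x. ?h x \<le> ereal c} = C" by auto
    then show ?thesis using assms by simp
  next
    case False
    then have "{x. ?h x \<le> ereal c} = {}" by auto
    then show ?thesis by simp
  qed
  then obtain p where p: "is_arg_min (\<lambda>y. ?h y + ereal (inner (y - 0) (y - 0) / 2)) (\<lambda>_. True) p"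
    using minimizer_exists[OF h cv, of 0] by blast
  have pC: "p \<in> C" using minimizer_variational(1)[OF h cv p] dom by simp
  moreover have "(norm (z - p))\<^sup>2 \<le> (norm z)\<^sup>2 - (norm p)\<^sup>2" if "z \<in> C" for z
    using minimizer_variational(2)[OF h cv p, of z] that pC dom
    by (simp add: power2_norm_eq_inner inner_diff_left inner_diff_right inner_commute[of p z])
  ultimately show ?thesis by blast
qed

text \<open>The points of minimal norm of the finite intersections form a Cauchy net, since their norms
  increase to a finite supremum.\<close>

lemma closed_convex_finite_intersection_property:
  fixes K :: "'a::{real_inner,complete_space} set"
  assumes K: "closed K" "convex K" "bounded K"
    and \<F>: "\<And>C. C \<in> \<F> \<Longrightarrow> closed C \<and> convex C"
    and fip: "\<And>\<G>. finite \<G> \<Longrightarrow> \<G> \<subseteq> \<F> \<Longrightarrow> K \<inter> \<Inter>\<G> \<noteq> {}"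
  shows "K \<inter> \<Inter>\<F> \<noteq> {}"
proof -
  define I where "I = {\<G>. finite \<G> \<and> \<G> \<subseteq> \<F>}"
  have "\<exists>p\<in>K \<inter> \<Inter>\<G>. \<forall>z\<in>K \<inter> \<Inter>\<G>. (norm (z - p))\<^sup>2 \<le> (norm z)\<^sup>2 - (norm p)\<^sup>2" if "\<G> \<in> I" for \<G>
  proof (rule min_norm_point_exists)
    show "closed (K \<inter> \<Inter>\<G>)" "convex (K \<inter> \<Inter>\<G>)"
      using K \<F> that by (auto simp: I_def intro!: closed_Int closed_Inter convex_Int convex_Inter)
    show "K \<inter> \<Inter>\<G> \<noteq> {}" using fip that by (auto simp: I_def)
  qed
  then obtain P where P: "\<And>\<G>. \<G> \<in> I \<Longrightarrow> P \<G> \<in> K \<inter> \<Inter>\<G>"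
    "\<And>\<G> z. \<G> \<in> I \<Longrightarrow> z \<in> K \<inter> \<Inter>\<G> \<Longrightarrow> (norm (z - P \<G>))\<^sup>2 \<le> (norm z)\<^sup>2 - (norm (P \<G>))\<^sup>2"
    by metis
  define d where "d \<G> = (norm (P \<G>))\<^sup>2" for \<G>
  have mono: "(norm (P \<H> - P \<G>))\<^sup>2 \<le> d \<H> - d \<G>" if "\<G> \<in> I" "\<H> \<in> I" "\<G> \<subseteq> \<H>" for \<G> \<H>
    unfolding d_def using P(1)[OF that(2)] that by (intro P(2)) auto
  obtain R where R: "\<And>z. z \<in> K \<Longrightarrow> norm z \<le> R" using K by (auto simp: bounded_iff)
  have bdd: "bdd_above (d ` I)"
    using P(1) R by (auto simp: d_def intro!: bdd_aboveI2[of _ _ "R\<^sup>2"] power_mono)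
  define s where "s = (SUP \<G>\<in>I. d \<G>)"
  have ds: "d \<G> \<le> s" if "\<G> \<in> I" for \<G>
    unfolding s_def using that bdd by (rule cSUP_upper)
  have ne: "I \<noteq> {}" by (auto simp: I_def)
  have "\<exists>\<G>\<in>I. s - inverse (real (Suc n)) < d \<G>" for n
  proof (rule ccontr)
    assume "\<not> ?thesis"
    then have "s \<le> s - inverse (real (Suc n))"
      using ne unfolding s_def by (intro cSUP_least) (auto simp: not_less)
    then show False by simp
  qed
  then obtain J where J: "\<And>n. J n \<in> I" "\<And>n. s - inverse (real (Suc n)) < d (J n)" by metis
  \<comment> \<open>The families \<open>J n\<close> need not be nested; their unions form a chain
    whose values still approach the supremum.\<close>
  define G where "G n = (\<Union>i\<le>n. J i)" for n
  have GI: "G n \<in> I" for n using J(1) by (auto simp: G_def I_def)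
  \<comment> \<open>Enlarging \<open>G n\<close> can raise the squared minimal norm only by what is
    left below \<open>s\<close>, and that gap controls the displacement.\<close>
  have near: "(norm (P \<H> - P (G n)))\<^sup>2 < inverse (real (Suc n))" if "\<H> \<in> I" "G n \<subseteq> \<H>" for n \<H>
  proof -
    have "(norm (P (G n) - P (J n)))\<^sup>2 \<le> d (G n) - d (J n)" by (intro mono J GI) (auto simp: G_def)
    then have "d (J n) \<le> d (G n)" using zero_le_power2[of "norm (P (G n) - P (J n))"] by linarith
    then show ?thesis using mono[OF GI that] J(2)[of n] ds[OF that(1)] by linarith
  qed
  have sq_tends: "X \<longlonglongrightarrow> 0" if "\<And>n. (norm (X n))\<^sup>2 \<le> inverse (real (Suc n))" for X :: "nat \<Rightarrow> 'a"
  proof -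
    have "(\<lambda>n. (norm (X n))\<^sup>2) \<longlonglongrightarrow> 0"
      by (rule tendsto_sandwich[OF always_eventually always_eventually tendsto_const
            LIMSEQ_inverse_real_of_nat]) (use that in auto)
    then have "(\<lambda>n. sqrt ((norm (X n))\<^sup>2)) \<longlonglongrightarrow> sqrt 0" by (rule tendsto_real_sqrt)
    then show ?thesis by (simp add: tendsto_norm_zero_iff)
  qed
  have "Cauchy (\<lambda>n. P (G n))"
  proof (rule CauchyI')
    fix e :: real assume e: "0 < e"
    then obtain N where N: "inverse (real (Suc N)) < e\<^sup>2" using reals_Archimedean[of "e\<^sup>2"] by auto
    have "dist (P (G m)) (P (G n)) < e" if "N \<le> m" "m < n" for m n
    proof -
      have "inverse (real (Suc m)) \<le> inverse (real (Suc N))" using that by (auto intro!: le_imp_inverse_le)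
      moreover have "G m \<subseteq> G n" using that unfolding G_def by (intro UN_mono) auto
      from near[OF GI this] have "(norm (P (G n) - P (G m)))\<^sup>2 < inverse (real (Suc m))" .
      ultimately have "(norm (P (G n) - P (G m)))\<^sup>2 < e\<^sup>2" using N by linarith
      then show ?thesis using e by (simp add: power2_less_imp_less dist_norm norm_minus_commute)
    qed
    then show "\<exists>N. \<forall>m\<ge>N. \<forall>n>m. dist (P (G m)) (P (G n)) < e" by blast
  qed
  then obtain p where p: "(\<lambda>n. P (G n)) \<longlonglongrightarrow> p" using Cauchy_convergent convergent_def by blast
  \<comment> \<open>Adding one set \<open>A\<close> to every \<open>G n\<close> shifts the minimal
    points by a null sequence, so the same limit \<open>p\<close> is approached from within
    \<open>A\<close>. A single sequence thus handles all of \<open>\<F>\<close>.\<close>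
  have mem: "p \<in> C" if C: "closed C" "\<And>n. P (insert A (G n)) \<in> C" and A: "A \<in> \<F>" for A C
  proof -
    have I: "insert A (G n) \<in> I" for n using GI[of n] A by (auto simp: I_def)
    have "(\<lambda>n. P (insert A (G n)) - P (G n)) \<longlonglongrightarrow> 0"
      by (rule sq_tends, rule less_imp_le, rule near[OF I]) auto
    from tendsto_add[OF this p] have "(\<lambda>n. P (insert A (G n))) \<longlonglongrightarrow> p" by simp
    then show ?thesis using C by (meson closed_sequentially)
  qed
  have "p \<in> A" if A: "A \<in> \<F>" for A
  proof (rule mem[OF _ _ A])
    have "insert A (G n) \<in> I" for n using GI[of n] A by (auto simp: I_def)
    then show "P (insert A (G n)) \<in> A" for n using P(1) by blast
  qed (use \<F> A in auto)
  moreover have "p \<in> K"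
    using closed_sequentially[OF K(1) _ p] P(1)[OF GI] by blast
  ultimately show ?thesis by blast
qed

text \<open>Half-spaces form a subbase of the weak topology, and their complements are closed and convex,
  so Alexander's subbase theorem applies.\<close>

lemma compactin_weak_topology:
  fixes K :: "'a::{real_inner,complete_space} set"
  assumes K: "closed K" "convex K" "bounded K"
  shows "compactin weak_topology K"
proof -
  define \<B> :: "'a set set" where "\<B> = {{x. inner x u < a} | u a. True}"
  \<comment> \<open>The topology on \<open>K\<close> generated by half-spaces, in the form of
    Alexander's theorem. Compactness passes to \<open>weak_topology\<close> along the identity
    map.\<close>
  define Y where "Y = topology (arbitrary union_of (finite intersection_of (\<lambda>x. x \<in> \<B>) relative_to K))"
  have top: "topspace Y = K" unfolding Y_def by (rule topspace_subbase)
  have "compact_space Y"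
  proof (rule Alexander_subbase_alt[OF _ _ Y_def[symmetric]])
    have "x \<in> {y. inner y 0 < 1}" for x :: 'a by simp
    then show "K \<subseteq> \<Union>\<B>" unfolding \<B>_def by blast
    fix \<C> assume \<C>: "\<C> \<subseteq> \<B>" "K \<subseteq> \<Union>\<C>"
    show "\<exists>\<C>'. finite \<C>' \<and> \<C>' \<subseteq> \<C> \<and> K \<subseteq> \<Union>\<C>'"
    proof (rule ccontr)
      assume neg: "\<not> ?thesis"
      have "K \<inter> \<Inter>(uminus ` \<C>) \<noteq> {}"
      proof (rule closed_convex_finite_intersection_property[OF K])
        fix C assume "C \<in> uminus ` \<C>"
        then obtain u a where "C = - {x. inner x u < a}" using \<C> by (auto simp: \<B>_def)
        then have "C = {x. inner u x \<ge> a}" by (auto simp: inner_commute not_less)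
        then show "closed C \<and> convex C" by (simp add: closed_halfspace_ge convex_halfspace_ge)
      next
        fix \<G> assume "finite \<G>" "\<G> \<subseteq> uminus ` \<C>"
        then obtain \<C>' where \<C>': "finite \<C>'" "\<C>' \<subseteq> \<C>" "\<G> = uminus ` \<C>'"
          by (meson finite_subset_image)
        with neg have "\<not> K \<subseteq> \<Union>\<C>'" by blast
        then show "K \<inter> \<Inter>\<G> \<noteq> {}" using \<C>' by blast
      qed
      then show False using \<C> by blast
    qed
  qed
  moreover have "continuous_map Y weak_topology (\<lambda>x. x)"
    unfolding weak_topology_def
  proof (rule continuous_on_generated_topo)
    have half: "openin Y {x \<in> topspace Y. inner x u < a}" for u a
    proof -
      have "{x \<in> topspace Y. inner x u < a} = K \<inter> {x. inner x u < a}" using top by auto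
      moreover have "(finite intersection_of (\<lambda>x. x \<in> \<B>)) {x. inner x u < a}"
        by (rule finite_intersection_of_inc) (auto simp: \<B>_def)
      ultimately show ?thesis
        unfolding Y_def openin_subbase by (metis arbitrary_union_of_inc relative_to_inc)
    qed
    fix V :: "'a set" assume "V \<in> {{x. inner x u \<in> U} | u U. open U}"
    then obtain u U where V: "V = {x. inner x u \<in> U}" "open U" by blast
    \<comment> \<open>Preimages of upper half-lines under \<open>u\<close> are preimages of lower
      ones under \<open>- u\<close>.\<close>
    have "continuous_map Y euclideanreal (\<lambda>x. inner x u)"
      unfolding continuous_map_upper_lower_semicontinuous_lt
      using half[of u] half[of "- u"] by (metis (no_types, lifting) Collect_cong inner_minus_right neg_less_iff_less)
    then have "openin Y {x \<in> topspace Y. inner x u \<in> U}"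
      by (rule openin_continuous_map_preimage) (use V in simp)
    moreover have "{x \<in> topspace Y. inner x u \<in> U} = (\<lambda>x. x) -` V \<inter> topspace Y" using V by auto
    ultimately show "openin Y ((\<lambda>x. x) -` V \<inter> topspace Y)" by simp
  next
    have "(UNIV :: 'a set) \<in> {{x. inner x u \<in> U} | u U. open U}" by blast
    then show "(\<lambda>x. x) ` topspace Y \<subseteq> \<Union>{{x. inner x u \<in> U} | u U. open U}" by blast
  qed
  ultimately show ?thesis using image_compactin[of Y K weak_topology "\<lambda>x. x"] top
    by (simp add: compact_space_def)
qed

section \<open>A single forward-backward step\<close>

locale fb_problem =
  fixes f g :: "'a::{real_inner,complete_space} \<Rightarrow> ereal"
  assumes f: "proper f" "ext_convex f"
    and g: "proper g" "ext_convex g" "lsc g"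
    and dom: "edom g \<subseteq> edom f"
    and differentiable: "gateaux_differentiable_on f (edom g)"
begin

abbreviation "fr x \<equiv> real_of_ereal (f x)"
abbreviation "gr x \<equiv> real_of_ereal (g x)"
abbreviation "G \<equiv> gateaux_gradient f"

lemma f_real: "x \<in> edom g \<Longrightarrow> f x = ereal (fr x)"
  using proper_real[OF f(1)] dom by blast

lemma g_real: "x \<in> edom g \<Longrightarrow> g x = ereal (gr x)"
  using proper_real[OF g(1)] by blast

text \<open>Makes the \<open>THE\<close> usable: two gradients at \<open>x\<close>, tested along
  their own difference, must coincide.\<close>

lemma has_gradient:
  assumes x: "x \<in> edom g"
  shows "has_gateaux_gradient f x (G x)"
proof -
  obtain u where u: "has_gateaux_gradient f x u"
    using differentiable x by (auto simp: gateaux_differentiable_on_def)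
  have "w = u" if w: "has_gateaux_gradient f x w" for w
  proof -
    have "ereal (inner (w - u) w) = ereal (inner (w - u) u)"
      using u w unfolding has_gateaux_gradient_def by (meson tendsto_unique at_neq_bot)
    then have "inner (w - u) (w - u) = 0" by (simp add: inner_diff_right)
    then show "w = u" by simp
  qed
  with u have "\<exists>!u. has_gateaux_gradient f x u" by blast
  then show ?thesis unfolding gateaux_gradient_def by (rule theI')
qed

text \<open>Only the base point has to lie in \<open>edom g\<close>. The extended quotient has a
  finite limit, so it is finite nearby, and this forces \<open>f\<close> to be finite at nearby
  points of the line on both sides.\<close>

lemma derivative_along_line:
  assumes "x + t *\<^sub>R d \<in> edom g"
  shows "((\<lambda>t. fr (x + t *\<^sub>R d)) has_real_derivative inner d (G (x + t *\<^sub>R d))) (at t)"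
proof -
  let ?p = "x + t *\<^sub>R d"
  let ?Q = "\<lambda>s. (f (?p + s *\<^sub>R d) - f ?p) / ereal s"
  have lim: "(?Q \<longlongrightarrow> ereal (inner d (G ?p))) (at 0)"
    using has_gradient[OF assms] by (simp add: has_gateaux_gradient_def)
  then have "((\<lambda>s. real_of_ereal (?Q s)) \<longlongrightarrow> inner d (G ?p)) (at 0)"
    by (rule lim_real_of_ereal)
  moreover have "eventually (\<lambda>s. real_of_ereal (?Q s) = (fr (x + (t + s) *\<^sub>R d) - fr ?p) / s) (at 0)"
  proof -
    have "eventually (\<lambda>s. ?Q s < \<infinity>) (at 0)" "eventually (\<lambda>s. - \<infinity> < ?Q s) (at 0)"
      by (intro order_tendstoD[OF lim]; simp)+
    moreover have "eventually (\<lambda>s::real. s \<noteq> 0) (at 0)"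
      by (simp add: eventually_at_filter)
    ultimately show ?thesis
    proof eventually_elim
      case (elim s)
      have "f (?p + s *\<^sub>R d) \<noteq> \<infinity>"
      proof
        assume "f (?p + s *\<^sub>R d) = \<infinity>"
        then have "?Q s = \<infinity> / ereal s" using f_real[OF assms] by (cases "f ?p") simp_all
        then show False using elim by (cases "0 < s") (simp_all add: divide_ereal_def)
      qed
      then have "?p + s *\<^sub>R d \<in> edom f" by (simp add: edom_def)
      then have "?Q s = (ereal (fr (?p + s *\<^sub>R d)) - ereal (fr ?p)) / ereal s"
        using f_real[OF assms] proper_real[OF f(1)] by presburger
      also have "\<dots> = ereal ((fr (?p + s *\<^sub>R d) - fr ?p) / s)" using elim by simp
      finally show ?case by (simp add: scaleR_add_left add.assoc)
    qed
  qed
  ultimately have "((\<lambda>s. (fr (x + (t + s) *\<^sub>R d) - fr ?p) / s) \<longlongrightarrow> inner d (G ?p)) (at 0)"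
    by (rule Lim_transform_eventually)
  then show ?thesis by (simp add: DERIV_def)
qed

lemma gradient_inequality:
  assumes x: "x \<in> edom g" and z: "z \<in> edom f"
  shows "fr x + inner (z - x) (G x) \<le> fr z"
proof -
  have "((\<lambda>t. (fr (x + (0 + t) *\<^sub>R (z - x)) - fr (x + 0 *\<^sub>R (z - x))) / t)
      \<longlongrightarrow> inner (z - x) (G (x + 0 *\<^sub>R (z - x)))) (at 0)"
    using derivative_along_line[of x 0 "z - x"] x unfolding DERIV_def by simp
  then have "((\<lambda>t. (fr (x + t *\<^sub>R (z - x)) - fr x) / t) \<longlongrightarrow> inner (z - x) (G x)) (at_right 0)"
    by (auto intro: filterlim_mono[OF _ order_refl at_le])
  moreover have "(fr (x + t *\<^sub>R (z - x)) - fr x) / t \<le> fr z - fr x" if t: "0 < t" "t < 1" for t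
  proof -
    have "x + t *\<^sub>R (z - x) = (1 - t) *\<^sub>R x + t *\<^sub>R z" by (simp add: algebra_simps)
    then have "fr (x + t *\<^sub>R (z - x)) - fr x \<le> t * (fr z - fr x)"
      using convex_on_real(2)[OF f, of x z t] x z t dom by (auto simp: algebra_simps)
    then show ?thesis using t by (simp add: divide_simps mult.commute)
  qed
  then have "eventually (\<lambda>t. (fr (x + t *\<^sub>R (z - x)) - fr x) / t \<le> fr z - fr x) (at_right 0)"
    by (auto simp: eventually_at_right_field intro!: exI[of _ 1])
  ultimately have "inner (z - x) (G x) \<le> fr z - fr x" by (intro tendsto_upperbound) auto
  then show ?thesis by simp
qed

lemma descent_lemma:
  assumes K: "convex K" "K \<subseteq> edom g" "L-lipschitz_on K G" and x: "x \<in> K" and z: "z \<in> K"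
  shows "fr z - fr x - inner (z - x) (G x) \<le> L / 2 * (norm (z - x))\<^sup>2"
proof -
  define d where "d = z - x"
  \<comment> \<open>The excess over the quadratic model. The Lipschitz bound makes its derivative
    nonpositive on the segment, which stands in for integrating the gradient.\<close>
  define \<psi> where "\<psi> t = fr (x + t *\<^sub>R d) - t * inner d (G x) - L / 2 * t\<^sup>2 * (norm d)\<^sup>2" for t
  have "\<psi> 1 \<le> \<psi> 0"
  proof (rule DERIV_nonpos_imp_nonincreasing[of 0 1 \<psi>])
    fix t :: real assume t: "0 \<le> t" "t \<le> 1"
    let ?w = "x + t *\<^sub>R d"
    have "?w = (1 - t) *\<^sub>R x + t *\<^sub>R z" by (simp add: d_def algebra_simps)
    then have w: "?w \<in> K" using convexD_alt[OF K(1) x z] t by simp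
    have "(\<psi> has_real_derivative (inner d (G ?w) - inner d (G x) - L * t * (norm d)\<^sup>2)) (at t)"
      unfolding \<psi>_def using w K(2)
      by (auto intro!: derivative_eq_intros derivative_along_line)
    moreover have "inner d (G ?w - G x) \<le> L * t * (norm d)\<^sup>2"
    proof -
      have "inner d (G ?w - G x) \<le> norm d * norm (G ?w - G x)" by (rule norm_cauchy_schwarz)
      also have "\<dots> \<le> norm d * (L * norm (?w - x))"
        using lipschitz_onD[OF K(3) w x] by (intro mult_left_mono) (auto simp: dist_norm)
      finally show ?thesis using t by (simp add: power2_eq_square algebra_simps)
    qed
    ultimately show "\<exists>y. (\<psi> has_real_derivative y) (at t) \<and> y \<le> 0"
      by (auto simp: inner_diff_right)
  qed simp
  then show ?thesis by (simp add: \<psi>_def d_def algebra_simps)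
qed

text \<open>The gradient inequality based at \<open>z\<close> instead of \<open>x\<close>. It lets
  the gradient comparison of LS4 control the linearization error of LS1.\<close>

lemma gradient_difference_bound:
  assumes "x \<in> edom g" "z \<in> edom g"
  shows "fr z - fr x - inner (z - x) (G x) \<le> inner (z - x) (G z - G x)"
  using gradient_inequality[of z x] assms dom
  by (auto simp: inner_diff_left inner_diff_right)

end

text \<open>On a geometric grid the predecessor of \<open>a\<close> is \<open>a / \<theta>\<close>;
  being larger, it was rejected. The bound \<open>a / \<theta> \<le> b\<close> is kept because trial
  points are controlled only for parameters in a bounded range.\<close>

lemma backtracking:
  fixes b \<theta> :: real
  assumes "is_arg_max (\<lambda>c. c) (\<lambda>c. c \<in> {b * \<theta> ^ i | i. True} \<and> P c) a"
    and b: "0 < b" and \<theta>: "0 < \<theta>" "\<theta> < 1"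
  shows "P a" "0 < a" "a \<le> b" "a = b \<or> (0 < a / \<theta> \<and> a / \<theta> \<le> b \<and> \<not> P (a / \<theta>))"
proof -
  obtain i where i: "a = b * \<theta> ^ i" using assms by (auto simp: is_arg_max_linorder)
  have max: "c \<le> a" if "c = b * \<theta> ^ j" "P c" for c j
    using assms(1) that by (auto simp: is_arg_max_linorder)
  show "P a" using assms by (auto simp: is_arg_max_linorder)
  show a: "0 < a" using i b \<theta> by simp
  show "a \<le> b" using i b \<theta> by (simp add: mult_le_cancel_left1 power_le_one)
  show "a = b \<or> (0 < a / \<theta> \<and> a / \<theta> \<le> b \<and> \<not> P (a / \<theta>))"
  proof (cases i)
    case (Suc j)
    then have j: "a / \<theta> = b * \<theta> ^ j" using i \<theta> by simp
    moreover have "a < a / \<theta>" using a \<theta> by (simp add: field_simps)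
    ultimately have "\<not> P (a / \<theta>)" using max by fastforce
    moreover have "a / \<theta> \<le> b" using j b \<theta> by (simp add: mult_le_cancel_left1 power_le_one)
    ultimately show ?thesis using a \<theta> by simp
  qed (use i in simp)
qed

locale fb_metric = scalar_metric S W \<nu> \<mu> + fb_problem f g
  for S :: "'a::{real_inner,complete_space} \<Rightarrow> 'a \<Rightarrow> real" and W \<nu> \<mu>
    and f g :: "'a \<Rightarrow> ereal"
begin

text \<open>The optimality condition of the prox, with the metric removed from the gradient term:
  since \<open>W M = G x\<close>, the product \<open>S M (z - p)\<close> is the ambient
  \<open>inner (z - p) (G x)\<close>.\<close>

lemma fb_point:
  fixes c :: real and x :: 'a
  defines "p \<equiv> fb_point f g S W x c"
  assumes c: "0 < c" and x: "x \<in> edom g"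
  shows "p \<in> edom g"
    and "z \<in> edom g \<Longrightarrow> S (x - p) (z - p) \<le> c * (gr z - gr p + inner (z - p) (G x))"
proof -
  define M where "M = metric_gradient W f x"
  define h where "h z = ereal c * g z" for z
  have WM: "W M = G x"
    unfolding M_def metric_gradient_def by (rule surj_f_inv_f[OF surj_operator])
  have hd: "edom h = edom g"
  proof -
    have "h z < \<infinity> \<longleftrightarrow> g z < \<infinity>" for z using c by (cases "g z") (auto simp: h_def)
    then show ?thesis by (simp add: edom_def)
  qed
  have h: "proper h"
    using g(1) c hd by (auto simp: proper_def h_def)
  have hr: "real_of_ereal (h z) = c * gr z" for z by (simp add: h_def)
  have hc: "ext_convex h"
    unfolding ext_convex_def
  proof (intro allI impI)
    fix x y :: 'a and t :: real assume t: "0 < t \<and> t < 1"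
    then have "h ((1 - t) *\<^sub>R x + t *\<^sub>R y) \<le> ereal c * (ereal (1 - t) * g x + ereal t * g y)"
      using g(2) c by (auto simp: h_def ext_convex_def intro!: ereal_mult_left_mono)
    also have "\<dots> = ereal (1 - t) * h x + ereal t * h y"
      using t c g(1) unfolding proper_def h_def
      by (cases "g x"; cases "g y") (auto simp: algebra_simps)
    finally show "h ((1 - t) *\<^sub>R x + t *\<^sub>R y) \<le> ereal (1 - t) * h x + ereal t * h y" .
  qed
  have "{z. h z \<le> ereal e} = {z. g z \<le> ereal (e / c)}" for e
  proof -
    have "h z \<le> ereal e \<longleftrightarrow> g z \<le> ereal (e / c)" for z
      using c by (cases "g z") (auto simp: h_def field_simps)
    then show ?thesis by simp
  qed
  then have cl: "closed {z. h z \<le> ereal e}" for e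
    using lsc_closed_sublevel[OF g(3)] by simp
  have "p = arg_min (\<lambda>y. h y + ereal (S (y - (x - c *\<^sub>R M)) (y - (x - c *\<^sub>R M)) / 2)) (\<lambda>_. True)"
    by (simp add: p_def fb_point_def prox_def sp_norm_sq h_def M_def)
  then have p: "is_arg_min (\<lambda>y. h y + ereal (S (y - (x - c *\<^sub>R M)) (y - (x - c *\<^sub>R M)) / 2)) (\<lambda>_. True) p"
    using minimizer_exists[OF h hc cl, of "x - c *\<^sub>R M"] unfolding arg_min_def by (metis someI_ex)
  show "p \<in> edom g" using minimizer_variational(1)[OF h hc p] hd by simp
  assume z: "z \<in> edom g"
  have "S (x - c *\<^sub>R M - p) (z - p) \<le> c * gr z - c * gr p"
    using minimizer_variational(2)[OF h hc p, of z] z hd by (simp add: hr)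
  moreover have "S M (z - p) = inner (z - p) (G x)" using commute[of M] WM by (simp add: eq_inner)
  moreover have "S (x - c *\<^sub>R M - p) (z - p) = S (x - p) (z - p) - c * S M (z - p)"
    by (simp add: diff_left scale_left)
  ultimately have "S (x - p) (z - p) - c * inner (z - p) (G x) \<le> c * gr z - c * gr p" by simp
  then show "S (x - p) (z - p) \<le> c * (gr z - gr p + inner (z - p) (G x))"
    unfolding right_diff_distrib distrib_left by linarith
qed

end

section \<open>Norm estimates for an equivalent metric and its operator\<close>

context scalar_metric
begin

lemma Cauchy_Schwarz: "\<bar>S x y\<bar> \<le> sp_norm S x * sp_norm S y"
proof (cases "y = 0")
  case True
  then have "S x y = 0" using scale_right[of x 0 y] by simp
  then show ?thesis by (simp add: sp_norm_def nonneg)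
next
  case False
  then have y: "0 < S y y" using scalar_product by (auto simp: is_scalar_product_def)
  define t where "t = S x y / S y y"
  have ty: "t * S y y = S x y" using y by (simp add: t_def)
  have "0 \<le> S (x - t *\<^sub>R y) (x - t *\<^sub>R y)" by (rule nonneg)
  also have "\<dots> = S x x - t * S x y" using ty commute[of y x] by (simp add: expand)
  finally have "t * S x y * S y y \<le> S x x * S y y" using y by (intro mult_right_mono) auto
  then have "(S x y)\<^sup>2 \<le> S x x * S y y" using y by (simp add: t_def power2_eq_square)
  then show ?thesis
    unfolding sp_norm_def real_sqrt_mult[symmetric] by (metis real_sqrt_abs real_sqrt_le_mono)
qed

lemma norm_le_sp_norm: "sqrt \<nu> * norm z \<le> sp_norm S z"
  using real_sqrt_le_mono[OF lower[of z]] by (simp add: sp_norm_def real_sqrt_mult)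

text \<open>From \<open>S w w = inner w (W w)\<close> and Cauchy-Schwarz. Applied to differences of
  metric gradients, where \<open>W w\<close> is a difference of ordinary gradients.\<close>

lemma sp_norm_le_operator: "sp_norm S w \<le> norm (W w) / sqrt \<nu>"
proof (cases "sp_norm S w = 0")
  case False
  then have s: "0 < sp_norm S w" by (simp add: sp_norm_def nonneg less_le)
  have "sqrt \<nu> * (sp_norm S w)\<^sup>2 = sqrt \<nu> * inner w (W w)" by (simp add: sp_norm_sq eq_inner)
  also have "\<dots> \<le> (sqrt \<nu> * norm w) * norm (W w)"
    using pos by (simp add: norm_cauchy_schwarz)
  also have "\<dots> \<le> sp_norm S w * norm (W w)"
    by (intro mult_right_mono norm_le_sp_norm) simp
  finally have "sqrt \<nu> * sp_norm S w \<le> norm (W w)"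
    using s by (simp add: power2_eq_square)
  then show ?thesis using pos by (simp add: field_simps)
qed (use pos in simp)

lemma operator_diff: "W (x - y) = W x - W y"
proof -
  have "inner z (W (x - y) - (W x - W y)) = 0" for z
    using diff_right[of z x y] by (simp add: eq_inner inner_diff_right)
  then show ?thesis by (metis inner_eq_zero_iff eq_iff_diff_eq_0)
qed

end

section \<open>Acceptance tests, their implications and their failure\<close>

context fb_metric
begin

text \<open>Shared by LS1 and LS2, which differ only in whether \<open>c\<close> or \<open>l\<close>
  is searched. Real-valued, because every point involved lies in \<open>edom g\<close>.\<close>

definition quadratic_test :: "real \<Rightarrow> real \<Rightarrow> real \<Rightarrow> 'a \<Rightarrow> bool" where
  "quadratic_test \<delta> c l x \<longleftrightarrow> (let J = fb_step f g S W x c l in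
     fr J - fr x - inner (J - x) (G x) \<le> \<delta> / (c * l) * (sp_norm S (J - x))\<^sup>2)"

definition armijo_test :: "real \<Rightarrow> real \<Rightarrow> real \<Rightarrow> 'a \<Rightarrow> bool" where
  "armijo_test \<delta> c l x \<longleftrightarrow> (let J = fb_step f g S W x c l; p = fb_point f g S W x c in
     (fr J + gr J) - (fr x + gr x) \<le> (1 - \<delta>) * l * (gr p - gr x + inner (p - x) (G x)))"

definition gradient_test :: "real \<Rightarrow> real \<Rightarrow> real \<Rightarrow> 'a \<Rightarrow> bool" where
  "gradient_test \<delta> c l x \<longleftrightarrow> (let J = fb_step f g S W x c l in
     sp_norm S (metric_gradient W f J - metric_gradient W f x) \<le> \<delta> / (c * l) * sp_norm S (J - x))"

lemma step_mem:
  assumes "convex K" "x \<in> K" "fb_point f g S W x c \<in> K" "0 \<le> l" "l \<le> 1"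
  shows "fb_step f g S W x c l \<in> K"
proof -
  have "fb_step f g S W x c l = (1 - l) *\<^sub>R x + l *\<^sub>R fb_point f g S W x c"
    by (simp add: fb_step_def algebra_simps)
  then show ?thesis using assms convexD_alt[OF assms(1)] by simp
qed

lemma convex_edom: "convex (edom g)"
  using convex_on_real(1)[OF g(1,2)] by (force simp: convex_alt)

lemma step_edom:
  assumes "x \<in> edom g" "0 < c" "0 \<le> l" "l \<le> 1"
  shows "fb_step f g S W x c l \<in> edom g"
  using step_mem[OF convex_edom] fb_point(1) assms by blast

lemma quadratic_test_ereal:
  assumes "x \<in> edom g" "0 < c" "0 \<le> l" "l \<le> 1"
  shows "(let J = fb_step f g S W x c l in
      f J - f x - ereal (inner (J - x) (G x)) \<le> ereal (\<delta> / (c * l) * (sp_norm S (J - x))\<^sup>2))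
    \<longleftrightarrow> quadratic_test \<delta> c l x"
  using f_real[OF assms(1)] f_real[OF step_edom[OF assms]]
  unfolding quadratic_test_def Let_def by (metis ereal_less_eq(3) ereal_minus(1))

lemma armijo_test_ereal:
  assumes "x \<in> edom g" "0 < c" "0 \<le> l" "l \<le> 1"
  shows "(let J = fb_step f g S W x c l in
      (f J + g J) - (f x + g x) \<le> ereal ((1 - \<delta>) * l) *
        (g (fb_point f g S W x c) - g x + ereal (inner (fb_point f g S W x c - x) (G x))))
    \<longleftrightarrow> armijo_test \<delta> c l x"
proof -
  note r = f_real[OF assms(1)] g_real[OF assms(1)] f_real[OF step_edom[OF assms]]
    g_real[OF step_edom[OF assms]] g_real[OF fb_point(1)[OF assms(2,1)]]
  obtain a1 a2 a3 a4 a5 where "f x = ereal a1" "g x = ereal a2" "f (fb_step f g S W x c l) = ereal a3"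
    "g (fb_step f g S W x c l) = ereal a4" "g (fb_point f g S W x c) = ereal a5" using r by blast
  then show ?thesis unfolding armijo_test_def Let_def by simp
qed

text \<open>The variational inequality tested at \<open>x\<close> itself. It shows that the
  predicted change of the objective is nonpositive and dominates the squared step.\<close>

lemma model_decrease:
  assumes "x \<in> edom g" "0 < c"
  defines "p \<equiv> fb_point f g S W x c"
  shows "S (p - x) (p - x) \<le> - c * (gr p - gr x + inner (p - x) (G x))"
proof -
  have "S (x - p) (x - p) \<le> c * (gr x - gr p + inner (x - p) (G x))"
    using fb_point(2)[OF assms(2,1) assms(1)] by (simp add: p_def)
  moreover have "S (x - p) (x - p) = S (p - x) (p - x)" by (simp add: expand)
  ultimately show ?thesis by (simp add: inner_diff_left algebra_simps)
qed

text \<open>Convexity bounds the change of \<open>g\<close> by \<open>l\<close> times its change at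
  the prox point. The tolerated error is \<open>\<delta> * l / c\<close> times the squared prox
  step, at most the fraction \<open>\<delta>\<close> of the predicted decrease
  \<open>- l * D\<close>, so the fraction \<open>1 - \<delta>\<close> remains.\<close>

lemma quadratic_imp_armijo:
  assumes x: "x \<in> edom g" and c: "0 < c" and l: "0 < l" "l \<le> 1" and \<delta>: "0 \<le> \<delta>"
    and test: "quadratic_test \<delta> c l x"
  shows "armijo_test \<delta> c l x"
proof -
  define p where "p = fb_point f g S W x c"
  define J where "J = fb_step f g S W x c l"
  define D where "D = gr p - gr x + inner (p - x) (G x)"
  have Jx: "J - x = l *\<^sub>R (p - x)" by (simp add: J_def p_def fb_step_def)
  have "J = (1 - l) *\<^sub>R x + l *\<^sub>R p" using Jx by (simp add: algebra_simps)
  then have gJ: "gr J \<le> (1 - l) * gr x + l * gr p"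
    using convex_on_real(2)[OF g(1,2) x fb_point(1)[OF c x]] l by (simp add: p_def)
  have "fr J - fr x - inner (J - x) (G x) \<le> \<delta> / (c * l) * S (J - x) (J - x)"
    using test by (simp add: quadratic_test_def Let_def J_def sp_norm_sq)
  also have "\<dots> = \<delta> * l / c * S (p - x) (p - x)"
    using l by (simp add: Jx scale_left scale_right)
  also have "\<dots> \<le> \<delta> * l / c * (- c * D)"
    using model_decrease[OF x c] l c \<delta> by (intro mult_left_mono) (simp_all add: D_def p_def)
  also have "\<dots> = - \<delta> * l * D" using c by simp
  finally have "fr J - fr x \<le> l * inner (p - x) (G x) - \<delta> * l * D" by (simp add: Jx)
  moreover have "l * D = l * gr p - l * gr x + l * inner (p - x) (G x)"
    by (simp add: D_def algebra_simps)
  ultimately have "(fr J + gr J) - (fr x + gr x) \<le> (1 - \<delta>) * l * D"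
    using gJ by (simp add: algebra_simps)
  then show ?thesis by (simp add: armijo_test_def Let_def J_def p_def D_def)
qed

lemma metric_gradient_operator: "W (metric_gradient W f z) = G z"
  unfolding metric_gradient_def by (rule surj_f_inv_f[OF surj_operator])

text \<open>The linearization error is at most \<open>S (J - x) w\<close> for the difference
  \<open>w\<close> of metric gradients, so Cauchy-Schwarz in the metric inserts the tested
  norm.\<close>

lemma gradient_imp_quadratic:
  assumes x: "x \<in> edom g" and c: "0 < c" and l: "0 < l" "l \<le> 1"
    and test: "gradient_test \<delta> c l x"
  shows "quadratic_test \<delta> c l x"
proof -
  define J where "J = fb_step f g S W x c l"
  define w where "w = metric_gradient W f J - metric_gradient W f x"
  have J: "J \<in> edom g" using step_edom[OF x c] l by (simp add: J_def)
  have "fr J - fr x - inner (J - x) (G x) \<le> inner (J - x) (W w)"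
    using gradient_difference_bound[OF x J] by (simp add: w_def operator_diff metric_gradient_operator)
  also have "\<dots> \<le> sp_norm S (J - x) * sp_norm S w"
    using Cauchy_Schwarz[of "J - x" w] by (simp add: eq_inner)
  also have "\<dots> \<le> sp_norm S (J - x) * (\<delta> / (c * l) * sp_norm S (J - x))"
    using test by (intro mult_left_mono)
      (simp_all add: gradient_test_def Let_def J_def w_def sp_norm_def nonneg)
  finally show ?thesis
    by (simp add: quadratic_test_def Let_def J_def power2_eq_square mult_ac)
qed

lemma quadratic_test_fails:
  assumes K: "convex K" "K \<subseteq> edom g" "L-lipschitz_on K G"
    and x: "x \<in> K" "fb_point f g S W x c \<in> K" and c: "0 < c" and l: "0 < l" "l \<le> 1"
    and \<delta>: "0 \<le> \<delta>" and fails: "\<not> quadratic_test \<delta> c l x"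
  shows "2 * \<delta> * \<nu> < L * (c * l)"
proof -
  define J where "J = fb_step f g S W x c l"
  have J: "J \<in> K" using step_mem[OF K(1) x] l by (simp add: J_def)
  have cl: "0 < c * l" using c l by simp
  have "\<delta> / (c * l) * (\<nu> * (norm (J - x))\<^sup>2) \<le> \<delta> / (c * l) * S (J - x) (J - x)"
    using \<delta> cl by (intro mult_left_mono lower) simp
  also have "\<dots> < fr J - fr x - inner (J - x) (G x)"
    using fails by (simp add: quadratic_test_def Let_def J_def sp_norm_sq)
  also have "\<dots> \<le> L / 2 * (norm (J - x))\<^sup>2" by (rule descent_lemma[OF K x(1) J])
  finally have "(\<delta> / (c * l) * \<nu>) * (norm (J - x))\<^sup>2 < L / 2 * (norm (J - x))\<^sup>2" by (simp add: mult_ac)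
  \<comment> \<open>Strictness already excludes \<open>J = x\<close>, so the squared norm
    cancels.\<close>
  then have "\<delta> / (c * l) * \<nu> < L / 2" by (rule mult_right_less_imp_less) simp
  then show ?thesis using cl by (simp add: field_simps)
qed

text \<open>Passing to the ambient norm costs one \<open>sqrt \<nu>\<close> for the gradients and
  one for the displacement, together \<open>\<nu>\<close>.\<close>

lemma gradient_test_fails:
  assumes K: "convex K" "K \<subseteq> edom g" "L-lipschitz_on K G"
    and x: "x \<in> K" "fb_point f g S W x c \<in> K" and c: "0 < c" and l: "0 < l" "l \<le> 1"
    and fails: "\<not> gradient_test \<delta> c l x"
  shows "\<delta> * \<nu> < L * (c * l)"
proof -
  define J where "J = fb_step f g S W x c l"
  define w where "w = metric_gradient W f J - metric_gradient W f x"
  have J: "J \<in> K" using step_mem[OF K(1) x] l by (simp add: J_def)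
  have L: "0 \<le> L" using K(3) by (rule lipschitz_on_nonneg)
  have cl: "0 < c * l" using c l by simp
  have "\<delta> / (c * l) * sp_norm S (J - x) < sp_norm S w"
    using fails by (simp add: gradient_test_def Let_def J_def w_def)
  also have "\<dots> \<le> norm (G J - G x) / sqrt \<nu>"
    using sp_norm_le_operator[of w] by (simp add: w_def operator_diff metric_gradient_operator)
  also have "\<dots> \<le> L * norm (J - x) / sqrt \<nu>"
    using lipschitz_onD[OF K(3) J x(1)] pos by (intro divide_right_mono) (simp_all add: dist_norm)
  also have "\<dots> \<le> L * (sp_norm S (J - x) / sqrt \<nu>) / sqrt \<nu>"
    using norm_le_sp_norm[of "J - x"] pos L
    by (intro divide_right_mono mult_left_mono) (simp_all add: field_simps)
  also have "\<dots> = L / \<nu> * sp_norm S (J - x)" using pos by simp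
  finally have "\<delta> / (c * l) < L / \<nu>"
    by (rule mult_right_less_imp_less) (simp add: sp_norm_def nonneg)
  then show ?thesis using cl pos by (simp add: field_simps)
qed

text \<open>The prox inequality at \<open>z\<close> gives
  \<open>S a b + S b b \<le> - c * D\<close>. Expanding the square of
  \<open>a + l *\<^sub>R b\<close>, the estimate \<open>l * l \<le> 2 * l\<close> absorbs the
  quadratic term, and the Armijo test trades \<open>- l * D\<close> for the decrease of the
  objective, whence \<open>2 * c / (1 - \<delta>)\<close>.\<close>

lemma fejer_step:
  assumes x: "x \<in> edom g" and c: "0 < c" and l: "0 < l" "l \<le> 1" and \<delta>: "\<delta> < 1"
    and test: "armijo_test \<delta> c l x"
    and z: "z \<in> edom g" "fr z + gr z \<le> fr x + gr x"
  defines "J \<equiv> fb_step f g S W x c l"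
  shows "S (J - z) (J - z) \<le> S (x - z) (x - z) + 2 * c / (1 - \<delta>) * ((fr x + gr x) - (fr J + gr J))"
proof -
  define p where "p = fb_point f g S W x c"
  define D where "D = gr p - gr x + inner (p - x) (G x)"
  define a where "a = x - z"
  define b where "b = p - x"
  have Jz: "J - z = a + l *\<^sub>R b" by (simp add: J_def p_def a_def b_def fb_step_def)
  have "S (x - p) (z - p) \<le> c * (gr z - gr p + inner (z - p) (G x))"
    unfolding p_def by (rule fb_point(2)[OF c x z(1)])
  moreover have "x - p = - b" "z - p = - (a + b)" by (simp_all add: a_def b_def)
  moreover have "S (- b) (- (a + b)) = S a b + S b b"
    unfolding minus_left minus_right using commute[of b a] by (simp add: add_right)
  moreover have "inner (z - p) (G x) = inner (z - x) (G x) - inner (p - x) (G x)"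
    by (simp add: inner_diff_left)
  \<comment> \<open>Here \<open>z\<close> being no worse than \<open>x\<close> is used: with the
    gradient inequality it replaces the values at \<open>z\<close> by those at
    \<open>x\<close>.\<close>
  moreover have "gr z - gr p + (inner (z - x) (G x) - inner (p - x) (G x)) \<le> - D"
    using gradient_inequality[OF x, of z] z dom by (auto simp: D_def)
  then have "c * (gr z - gr p + (inner (z - x) (G x) - inner (p - x) (G x))) \<le> c * (- D)"
    using c by (intro mult_left_mono) auto
  ultimately have ab: "S a b + S b b \<le> - c * D" by simp
  have D: "0 \<le> - D"
    using order_trans[OF nonneg model_decrease[OF x c]] c
    by (auto simp: D_def p_def mult_le_0_iff zero_le_mult_iff)
  have "l * (l * S b b) \<le> l * (2 * S b b)" using l nonneg[of b] by (intro mult_left_mono mult_right_mono) auto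
  moreover have "S (J - z) (J - z) = S a a + 2 * l * S a b + l * (l * S b b)"
    unfolding Jz using commute[of b a] by (simp add: expand algebra_simps)
  moreover have "l * (2 * (S a b + S b b)) \<le> l * (2 * (- c * D))"
    using l ab by (intro mult_left_mono) auto
  ultimately have "S (J - z) (J - z) \<le> S a a + 2 * c * (- l * D)" by (simp add: algebra_simps)
  moreover have "- l * D \<le> ((fr x + gr x) - (fr J + gr J)) / (1 - \<delta>)"
    using test \<delta> by (simp add: armijo_test_def Let_def J_def p_def D_def field_simps)
  then have "2 * c * (- l * D) \<le> 2 * c * (((fr x + gr x) - (fr J + gr J)) / (1 - \<delta>))"
    using c by (intro mult_left_mono) auto
  ultimately show ?thesis by (simp add: a_def)
qed

lemma armijo_nonincreasing:
  assumes x: "x \<in> edom g" and c: "0 < c" and l: "0 < l" and \<delta>: "\<delta> < 1"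
    and test: "armijo_test \<delta> c l x"
  defines "J \<equiv> fb_step f g S W x c l"
  shows "fr J + gr J \<le> fr x + gr x"
proof -
  define p where "p = fb_point f g S W x c"
  have "gr p - gr x + inner (p - x) (G x) \<le> 0"
    using order_trans[OF nonneg model_decrease[OF x c]] c
    by (auto simp: p_def mult_le_0_iff zero_le_mult_iff)
  then have "(1 - \<delta>) * l * (gr p - gr x + inner (p - x) (G x)) \<le> 0"
    using l \<delta> by (intro mult_nonneg_nonpos) auto
  then show ?thesis using test by (simp add: armijo_test_def Let_def J_def p_def)
qed

end

section \<open>Backtracking along a run of the algorithm\<close>

text \<open>A discrete Gronwall estimate: \<open>1 + \<eta> k \<le> exp (\<eta> k)\<close> turns the
  product of the factors into the exponential of a sum. Both hypotheses on the metrics lead to this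
  recursion.\<close>

lemma quasi_fejer_bounded:
  fixes a \<eta> \<epsilon> :: "nat \<Rightarrow> real"
  assumes step: "\<And>k. a (Suc k) \<le> (1 + \<eta> k) * (a k + \<epsilon> k)"
    and a: "0 \<le> a 0" and \<eta>: "\<And>k. 0 \<le> \<eta> k" "summable \<eta>"
    and \<epsilon>: "\<And>k. 0 \<le> \<epsilon> k" "\<And>k. (\<Sum>i<k. \<epsilon> i) \<le> E"
  shows "a k \<le> exp (\<Sum>i. \<eta> i) * (a 0 + E)"
proof -
  have "a k \<le> exp (\<Sum>i<k. \<eta> i) * (a 0 + (\<Sum>i<k. \<epsilon> i))"
  proof (induction k)
    case (Suc k)
    have P: "1 \<le> exp (\<Sum>i<k. \<eta> i)" using \<eta> by (simp add: sum_nonneg)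
    have "a (Suc k) \<le> (1 + \<eta> k) * (a k + \<epsilon> k)" by (rule step)
    also have "\<dots> \<le> (1 + \<eta> k) * (exp (\<Sum>i<k. \<eta> i) * (a 0 + (\<Sum>i<k. \<epsilon> i)) + exp (\<Sum>i<k. \<eta> i) * \<epsilon> k)"
      using Suc \<eta>(1)[of k] mult_right_mono[OF P \<epsilon>(1)[of k]]
      by (intro mult_left_mono add_mono) auto
    also have "\<dots> \<le> exp (\<eta> k) * (exp (\<Sum>i<k. \<eta> i) * (a 0 + (\<Sum>i<k. \<epsilon> i)) + exp (\<Sum>i<k. \<eta> i) * \<epsilon> k)"
      using exp_ge_add_one_self[of "\<eta> k"] a \<epsilon>(1)
      by (intro mult_right_mono) (auto intro!: add_nonneg_nonneg mult_nonneg_nonneg sum_nonneg)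
    also have "\<dots> = exp (\<Sum>i<Suc k. \<eta> i) * (a 0 + (\<Sum>i<Suc k. \<epsilon> i))"
      by (simp add: exp_add algebra_simps)
    finally show ?case .
  qed simp
  also have "\<dots> \<le> exp (\<Sum>i. \<eta> i) * (a 0 + E)"
    using \<eta> \<epsilon> a by (intro mult_mono add_mono) (auto intro!: sum_le_suminf add_nonneg_nonneg sum_nonneg)
  finally show ?thesis .
qed

text \<open>The alternative is multiplied out so that \<open>L = 0\<close> stays meaningful:
  \<open>C > 0\<close> then forces \<open>a k = A\<close>, while the quotient is infinite and drops
  out of the minimum.\<close>

lemma min_le_INF:
  fixes a b :: "nat \<Rightarrow> real" and A C L :: real
  assumes alt: "\<And>k. a k = A \<or> C \<le> a k * (L * b k)"
    and b: "\<And>k. 0 < b k" "(SUP k. ereal (b k)) < \<infinity>" and L: "0 \<le> L" and C: "0 < C"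
  shows "min (ereal A) (ereal C / (ereal L * (SUP k. ereal (b k)))) \<le> (INF k. ereal (a k))"
proof (rule INF_greatest)
  fix k
  have "ereal (b 0) \<le> (SUP k. ereal (b k))" by (rule SUP_upper) simp
  then obtain B where B: "(SUP k. ereal (b k)) = ereal B"
    using b(2) by (cases "SUP k. ereal (b k)") auto
  show "min (ereal A) (ereal C / (ereal L * (SUP k. ereal (b k)))) \<le> ereal (a k)"
  proof (cases "a k = A")
    case False
    then have k: "C \<le> a k * (L * b k)" using alt by blast
    have bB: "b k \<le> B" using SUP_upper[of k UNIV "\<lambda>k. ereal (b k)"] by (simp add: B)
    have Lp: "0 < L" using k C L by (cases "L = 0") auto
    then have "0 < L * b k" using b by simp
    with k C have a: "0 < a k" by (meson less_le_trans zero_less_mult_pos2)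
    have "C \<le> a k * (L * B)"
      using k a Lp bB by (meson mult_left_mono less_imp_le order_trans)
    moreover have "0 < L * B" using Lp b(1)[of k] bB by simp
    ultimately have "C / (L * B) \<le> a k" by (simp add: pos_divide_le_eq)
    moreover have "ereal C / (ereal L * ereal B) = ereal (C / (L * B))"
      using \<open>0 < L * B\<close> by (subst times_ereal.simps(1), subst ereal_divide) auto
    ultimately have "ereal C / (ereal L * ereal B) \<le> ereal (a k)" by simp
    then show ?thesis by (simp add: B min.coboundedI2)
  qed (simp add: min.coboundedI1)
qed

lemma min_quotient_pos:
  fixes b :: "nat \<Rightarrow> real"
  assumes b: "\<And>k. 0 < b k" "(SUP k. ereal (b k)) < \<infinity>" and L: "0 \<le> L" and C: "0 < C" and A: "0 < A"
  shows "0 < min (ereal A) (ereal C / (ereal L * (SUP k. ereal (b k))))"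
proof -
  have "ereal (b 0) \<le> (SUP k. ereal (b k))" by (rule SUP_upper) simp
  moreover from this obtain B where B: "(SUP k. ereal (b k)) = ereal B"
    using b(2) by (cases "SUP k. ereal (b k)") auto
  ultimately have "0 < B" using b(1)[of 0] by simp
  then show ?thesis using L C A by (cases "L = 0") (simp_all add: B divide_ereal_def)
qed

locale vm_fbs_run = fb_problem f g
  for f g :: "'a::{real_inner,complete_space} \<Rightarrow> ereal" +
  fixes S :: "nat \<Rightarrow> 'a \<Rightarrow> 'a \<Rightarrow> real" and W :: "nat \<Rightarrow> 'a \<Rightarrow> 'a"
    and x y :: "nat \<Rightarrow> 'a" and \<gamma> lam :: "nat \<Rightarrow> real" and \<nu> \<mu> \<delta> \<theta> :: real
  assumes metric: "\<And>k. scalar_metric (S k) (W k) \<nu> \<mu>"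
    and run: "vm_fbs f g S W x y \<gamma> lam"
    and \<delta>: "0 < \<delta>" "\<delta> < 1" and \<theta>: "0 < \<theta>" "\<theta> < 1"

sublocale vm_fbs_run \<subseteq> step: fb_metric "S k" "W k" \<nu> \<mu> f g for k
  by (intro fb_metric.intro metric) unfold_locales

context vm_fbs_run
begin

lemma params: "0 < \<gamma> k" "0 < lam k" "lam k \<le> 1"
  and y_eq: "y k = fb_point f g (S k) (W k) (x k) (\<gamma> k)"
  and x_Suc: "x (Suc k) = fb_step f g (S k) (W k) (x k) (\<gamma> k) (lam k)"
  using run by (simp_all add: vm_fbs_def fb_step_def)

lemma x_edom: "x k \<in> edom g"
proof (induction k)
  case 0
  then show ?case using run by (simp add: vm_fbs_def)
next
  case (Suc k)
  then show ?case using step.step_edom params by (simp add: x_Suc less_imp_le)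
qed

lemma \<nu>_pos: "0 < \<nu>"
  using step.pos .

lemma LS1_backtracking:
  assumes "LS1 f g S W \<delta> \<theta> b x \<gamma> lam"
  shows "step.quadratic_test k \<delta> (\<gamma> k) (lam k) (x k)" "\<gamma> k \<le> b"
    "\<gamma> k = b \<or> (0 < \<gamma> k / \<theta> \<and> \<gamma> k / \<theta> \<le> b \<and> \<not> step.quadratic_test k \<delta> (\<gamma> k / \<theta>) (lam k) (x k))"
proof -
  let ?P = "\<lambda>c. let J = fb_step f g (S k) (W k) (x k) c (lam k) in
      f J - f (x k) - ereal (inner (J - x k) (G (x k)))
        \<le> ereal (\<delta> / (c * lam k) * (sp_norm (S k) (J - x k))\<^sup>2)"
  have b: "0 < b" and m: "is_arg_max (\<lambda>c. c) (\<lambda>c. c \<in> {b * \<theta> ^ i | i. True} \<and> ?P c) (\<gamma> k)"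
    using assms by (auto simp: LS1_def)
  note bt = backtracking[OF m b \<theta>]
  have iff: "?P c \<longleftrightarrow> step.quadratic_test k \<delta> c (lam k) (x k)" if "0 < c" for c
    using step.quadratic_test_ereal[OF x_edom that] params by (simp add: less_imp_le)
  show "step.quadratic_test k \<delta> (\<gamma> k) (lam k) (x k)" using bt(1) iff params(1) by blast
  show "\<gamma> k \<le> b" by (rule bt(3))
  show "\<gamma> k = b \<or> (0 < \<gamma> k / \<theta> \<and> \<gamma> k / \<theta> \<le> b \<and> \<not> step.quadratic_test k \<delta> (\<gamma> k / \<theta>) (lam k) (x k))"
    using bt(4) iff by blast
qed

lemma LS4_backtracking:
  assumes "LS4 f g S W \<delta> \<theta> b x \<gamma> lam"
  shows "step.gradient_test k \<delta> (\<gamma> k) (lam k) (x k)" "\<gamma> k \<le> b"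
    "\<gamma> k = b \<or> (0 < \<gamma> k / \<theta> \<and> \<gamma> k / \<theta> \<le> b \<and> \<not> step.gradient_test k \<delta> (\<gamma> k / \<theta>) (lam k) (x k))"
proof -
  have b: "0 < b" and m: "is_arg_max (\<lambda>c. c) (\<lambda>c. c \<in> {b * \<theta> ^ i | i. True} \<and>
      step.gradient_test k \<delta> c (lam k) (x k)) (\<gamma> k)"
    using assms by (auto simp: LS4_def step.gradient_test_def)
  note bt = backtracking[OF m b \<theta>]
  show "step.gradient_test k \<delta> (\<gamma> k) (lam k) (x k)" "\<gamma> k \<le> b"
    "\<gamma> k = b \<or> (0 < \<gamma> k / \<theta> \<and> \<gamma> k / \<theta> \<le> b \<and> \<not> step.gradient_test k \<delta> (\<gamma> k / \<theta>) (lam k) (x k))"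
    using bt by auto
qed

lemma LS2_backtracking:
  assumes "LS2 f g S W \<delta> \<theta> b x \<gamma> lam"
  shows "step.quadratic_test k \<delta> (\<gamma> k) (lam k) (x k)"
    "lam k = b \<or> (0 < lam k / \<theta> \<and> lam k / \<theta> \<le> 1 \<and> \<not> step.quadratic_test k \<delta> (\<gamma> k) (lam k / \<theta>) (x k))"
proof -
  let ?P = "\<lambda>l. let J = fb_step f g (S k) (W k) (x k) (\<gamma> k) l in
      f J - f (x k) - ereal (inner (J - x k) (G (x k)))
        \<le> ereal (\<delta> / (\<gamma> k * l) * (sp_norm (S k) (J - x k))\<^sup>2)"
  have b: "0 < b" "b \<le> 1"
    and m: "is_arg_max (\<lambda>l. l) (\<lambda>l. l \<in> {b * \<theta> ^ i | i. True} \<and> ?P l) (lam k)"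
    using assms by (auto simp: LS2_def)
  note bt = backtracking[OF m b(1) \<theta>]
  have iff: "?P l \<longleftrightarrow> step.quadratic_test k \<delta> (\<gamma> k) l (x k)" if "0 < l" "l \<le> 1" for l
    using step.quadratic_test_ereal[OF x_edom params(1)] that by (simp add: less_imp_le)
  show "step.quadratic_test k \<delta> (\<gamma> k) (lam k) (x k)" using bt(1) iff params(2,3) by blast
  show "lam k = b \<or> (0 < lam k / \<theta> \<and> lam k / \<theta> \<le> 1 \<and> \<not> step.quadratic_test k \<delta> (\<gamma> k) (lam k / \<theta>) (x k))"
    using bt(4) iff b(2) order_trans by blast
qed

lemma LS3_backtracking:
  assumes "LS3 f g S W \<delta> \<theta> b x y \<gamma> lam"
  shows "step.armijo_test k \<delta> (\<gamma> k) (lam k) (x k)"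
    "lam k = b \<or> (0 < lam k / \<theta> \<and> lam k / \<theta> \<le> 1 \<and> \<not> step.armijo_test k \<delta> (\<gamma> k) (lam k / \<theta>) (x k))"
proof -
  let ?P = "\<lambda>l. let J = fb_step f g (S k) (W k) (x k) (\<gamma> k) l in
      (f J + g J) - (f (x k) + g (x k)) \<le> ereal ((1 - \<delta>) * l) *
        (g (y k) - g (x k) + ereal (inner (y k - x k) (G (x k))))"
  have b: "0 < b" "b \<le> 1"
    and m: "is_arg_max (\<lambda>l. l) (\<lambda>l. l \<in> {b * \<theta> ^ i | i. True} \<and> ?P l) (lam k)"
    using assms by (auto simp: LS3_def)
  note bt = backtracking[OF m b(1) \<theta>]
  have iff: "?P l \<longleftrightarrow> step.armijo_test k \<delta> (\<gamma> k) l (x k)" if "0 < l" "l \<le> 1" for l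
    unfolding y_eq using step.armijo_test_ereal[OF x_edom params(1)] that by (simp add: less_imp_le)
  show "step.armijo_test k \<delta> (\<gamma> k) (lam k) (x k)" using bt(1) iff params(2,3) by blast
  show "lam k = b \<or> (0 < lam k / \<theta> \<and> lam k / \<theta> \<le> 1 \<and> \<not> step.armijo_test k \<delta> (\<gamma> k) (lam k / \<theta>) (x k))"
    using bt(4) iff b(2) order_trans by blast
qed

section \<open>Parameter bounds on a convex set containing the iterates\<close>

context
  fixes K :: "'a set" and L :: real
  assumes K: "convex K" "K \<subseteq> edom g" "L-lipschitz_on K G" and xK: "\<And>k. x k \<in> K"
begin

text \<open>The failure estimate is applied at \<open>\<gamma> k / \<theta>\<close>, hence the
  factor \<open>\<theta>\<close>. The set must contain the prox points of all parameters up to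
  \<open>b\<close>, as it is the rejected one that is evaluated.\<close>

lemma LS1_lower_bound:
  assumes LS: "LS1 f g S W \<delta> \<theta> b x \<gamma> lam"
    and trial: "\<And>k c. 0 < c \<Longrightarrow> c \<le> b \<Longrightarrow> fb_point f g (S k) (W k) (x k) c \<in> K"
  shows "\<gamma> k = b \<or> 2 * \<delta> * \<theta> * \<nu> \<le> \<gamma> k * (L * lam k)"
  using LS1_backtracking(3)[OF LS, of k]
proof
  assume fail: "0 < \<gamma> k / \<theta> \<and> \<gamma> k / \<theta> \<le> b \<and> \<not> step.quadratic_test k \<delta> (\<gamma> k / \<theta>) (lam k) (x k)"
  then have "2 * \<delta> * \<nu> < L * (\<gamma> k / \<theta> * lam k)"
    using \<delta> trial[of "\<gamma> k / \<theta>" k] by (intro step.quadratic_test_fails[OF K xK]) (auto simp: params)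
  then show ?thesis using \<theta> by (simp add: field_simps)
qed simp

lemma LS4_lower_bound:
  assumes LS: "LS4 f g S W \<delta> \<theta> b x \<gamma> lam"
    and trial: "\<And>k c. 0 < c \<Longrightarrow> c \<le> b \<Longrightarrow> fb_point f g (S k) (W k) (x k) c \<in> K"
  shows "\<gamma> k = b \<or> \<delta> * \<theta> * \<nu> \<le> \<gamma> k * (L * lam k)"
  using LS4_backtracking(3)[OF LS, of k]
proof
  assume fail: "0 < \<gamma> k / \<theta> \<and> \<gamma> k / \<theta> \<le> b \<and> \<not> step.gradient_test k \<delta> (\<gamma> k / \<theta>) (lam k) (x k)"
  then have "\<delta> * \<nu> < L * (\<gamma> k / \<theta> * lam k)"
    using trial[of "\<gamma> k / \<theta>" k] by (intro step.gradient_test_fails[OF K xK]) (auto simp: params)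
  then show ?thesis using \<theta> by (simp add: field_simps)
qed simp

text \<open>By contraposition of \<open>quadratic_imp_armijo\<close>, a parameter rejected by LS3
  also fails the test of LS2. The prox parameter is fixed in both searches, so \<open>y k\<close> is
  the only prox point to control.\<close>

lemma LS2_LS3_lower_bound:
  assumes LS: "LS2 f g S W \<delta> \<theta> b x \<gamma> lam \<or> LS3 f g S W \<delta> \<theta> b x y \<gamma> lam"
    and trial: "\<And>k. y k \<in> K"
  shows "lam k = b \<or> 2 * \<delta> * \<theta> * \<nu> \<le> lam k * (L * \<gamma> k)"
proof -
  have "lam k = b \<or> (0 < lam k / \<theta> \<and> lam k / \<theta> \<le> 1 \<and> \<not> step.quadratic_test k \<delta> (\<gamma> k) (lam k / \<theta>) (x k))"
    using LS2_backtracking(2)[of b k] LS3_backtracking(2)[of b k] LS \<delta>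
      step.quadratic_imp_armijo[OF x_edom params(1)] by (meson less_imp_le)
  then show ?thesis
  proof
    assume fail: "0 < lam k / \<theta> \<and> lam k / \<theta> \<le> 1 \<and> \<not> step.quadratic_test k \<delta> (\<gamma> k) (lam k / \<theta>) (x k)"
    then have "2 * \<delta> * \<nu> < L * (\<gamma> k * (lam k / \<theta>))"
      using \<delta> trial[of k] y_eq by (intro step.quadratic_test_fails[OF K xK]) (auto simp: params)
    then show ?thesis using \<theta> by (simp add: field_simps)
  qed simp
qed

end

end

section \<open>Boundedness of the iterates and of all trial points\<close>

context vm_fbs_run
begin

abbreviation "obj z \<equiv> fr z + gr z"

context
  fixes z :: 'a and \<Gamma> :: real
  assumes z: "is_arg_min (\<lambda>z. f z + g z) (\<lambda>_. True) z"
    and armijo: "\<And>k. step.armijo_test k \<delta> (\<gamma> k) (lam k) (x k)"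
    and \<Gamma>: "\<And>k. \<gamma> k \<le> \<Gamma>"
begin

lemma \<Gamma>_pos: "0 < \<Gamma>"
  using params(1) \<Gamma> by (meson less_le_trans)

lemma z_edom: "z \<in> edom g"
proof -
  have "f z + g z \<le> f (x 0) + g (x 0)" using z by (auto simp: is_arg_min_linorder)
  also have "\<dots> < \<infinity>" using f_real[OF x_edom[of 0]] g_real[OF x_edom[of 0]]
    by (cases "f (x 0)"; cases "g (x 0)") auto
  finally show ?thesis using f(1) by (auto simp: edom_def proper_def)
qed

lemma obj_minimal: "w \<in> edom g \<Longrightarrow> obj z \<le> obj w"
  using z f_real[OF z_edom] g_real[OF z_edom] f_real[of w] g_real[of w]
  unfolding is_arg_min_linorder by (metis ereal_less_eq(3) plus_ereal.simps(1))

lemma obj_decreasing: "obj (x (Suc k)) \<le> obj (x k)"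
  unfolding x_Suc by (rule step.armijo_nonincreasing[OF x_edom params(1,2) \<delta>(2) armijo])

lemma obj_le: "obj (x k) \<le> obj (x 0)"
  by (induction k) (use obj_decreasing order_trans in auto)

text \<open>The decrease of the objective bounds the Fejer error, so the errors are summable.\<close>

lemma quasi_fejer:
  obtains \<epsilon> E where "\<And>k. 0 \<le> \<epsilon> k" "\<And>k. (\<Sum>i<k. \<epsilon> i) \<le> (E::real)"
    "\<And>k. S k (x (Suc k) - z) (x (Suc k) - z) \<le> S k (x k - z) (x k - z) + \<epsilon> k"
proof
  \<comment> \<open>The coefficient of \<open>fejer_step\<close> made uniform in \<open>k\<close>,
    so that the errors telescope; the minimal value \<open>obj z\<close> bounds the sum.\<close>
  define c where "c = 2 * \<Gamma> / (1 - \<delta>)"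
  have c: "0 \<le> c" using \<Gamma>_pos \<delta> by (simp add: c_def)
  define \<epsilon> where "\<epsilon> k = c * (obj (x k) - obj (x (Suc k)))" for k
  show "0 \<le> \<epsilon> k" for k
    using obj_decreasing[of k] c by (simp add: \<epsilon>_def)
  have "(\<Sum>i<k. \<epsilon> i) = c * (obj (x 0) - obj (x k))" for k
    unfolding \<epsilon>_def sum_distrib_left[symmetric]
    using sum_lessThan_telescope'[of "\<lambda>i. obj (x i)" k] by simp
  then show "(\<Sum>i<k. \<epsilon> i) \<le> c * (obj (x 0) - obj z)" for k
    using obj_minimal[OF x_edom, of k] c by (auto intro!: mult_left_mono)
  fix k
  have "S k (x (Suc k) - z) (x (Suc k) - z)
      \<le> S k (x k - z) (x k - z) + 2 * \<gamma> k / (1 - \<delta>) * (obj (x k) - obj (x (Suc k)))"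
    unfolding x_Suc
    by (rule step.fejer_step[OF x_edom params \<delta>(2) armijo z_edom obj_minimal[OF x_edom]])
  also have "2 * \<gamma> k / (1 - \<delta>) * (obj (x k) - obj (x (Suc k))) \<le> \<epsilon> k"
    unfolding \<epsilon>_def c_def using \<Gamma>[of k] \<delta> obj_decreasing[of k]
    by (intro mult_right_mono divide_right_mono) auto
  finally show "S k (x (Suc k) - z) (x (Suc k) - z) \<le> S k (x k - z) (x k - z) + \<epsilon> k" by simp
qed

text \<open>Iteration \<open>k\<close> is quasi-Fejer in its own metric; moving to the next metric
  costs the factor \<open>1 + \<eta> k\<close>, and \<open>\<nu>\<close> returns to the ambient
  norm.\<close>

lemma bounded_if_almost_monotone:
  assumes \<eta>: "\<And>k. 0 \<le> \<eta> k" "summable \<eta>"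
    and mono: "\<And>k z. (sp_norm (S (Suc k)) z)\<^sup>2 \<le> (1 + \<eta> k) * (sp_norm (S k) z)\<^sup>2"
  shows "\<exists>B. \<forall>k. (norm (x k - z))\<^sup>2 \<le> B"
proof -
  obtain \<epsilon> E where \<epsilon>: "\<And>k. 0 \<le> \<epsilon> k" "\<And>k. (\<Sum>i<k. \<epsilon> i) \<le> (E::real)"
    and fejer: "\<And>k. S k (x (Suc k) - z) (x (Suc k) - z) \<le> S k (x k - z) (x k - z) + \<epsilon> k"
    using quasi_fejer by metis
  have "S (Suc k) (x (Suc k) - z) (x (Suc k) - z) \<le> (1 + \<eta> k) * (S k (x k - z) (x k - z) + \<epsilon> k)" for k
    using order_trans[OF mono[of k "x (Suc k) - z", unfolded step.sp_norm_sq] mult_left_mono[OF fejer[of k]]] \<eta>(1)[of k]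
    by simp
  note bd = quasi_fejer_bounded[where a = "\<lambda>k. S k (x k - z) (x k - z)", OF this step.nonneg \<eta> \<epsilon>]
  have "(norm (x k - z))\<^sup>2 \<le> exp (suminf \<eta>) * (S 0 (x 0 - z) (x 0 - z) + E) / \<nu>" for k
    using order_trans[OF step.lower[of "x k - z" k] bd[of k]] \<nu>_pos by (simp add: pos_le_divide_eq mult.commute)
  then show ?thesis by blast
qed

text \<open>Consecutive metrics are not comparable with summable loss here, so each is compared with
  the ambient norm instead: \<open>N k\<close> and \<open>M k\<close> are its optimal constants, and
  the iterates are quasi-Fejer in the ambient norm with
  \<open>\<eta> k = (M k - N k) / \<nu>\<close>.\<close>

lemma bounded_if_almost_scalar:
  assumes summable: "summable (\<lambda>k. (SUP z\<in>{z. norm z = 1}. inner z (W k z))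
      - (INF z\<in>{z. norm z = 1}. inner z (W k z)))"
  shows "\<exists>B. \<forall>k. (norm (x k - z))\<^sup>2 \<le> B"
proof (cases "\<exists>u::'a. norm u = 1")
  \<comment> \<open>Without unit vectors the supremum and infimum run over the empty set and say
    nothing, but then the space is trivial.\<close>
  case False
  have "u = 0" for u :: 'a
  proof (rule ccontr)
    assume "u \<noteq> 0"
    then have "norm (u /\<^sub>R norm u) = 1" by simp
    with False show False by blast
  qed
  then have "norm (x k - z) = 0" for k by (metis norm_zero)
  then show ?thesis by (intro exI[of _ 0]) simp
next
  case True
  define M where "M k = (SUP z\<in>{z. norm z = 1}. inner z (W k z))" for k
  define N where "N k = (INF z\<in>{z. norm z = 1}. inner z (W k z))" for k
  have quad: "\<nu> \<le> inner u (W k u)" "inner u (W k u) \<le> \<mu>" if "norm u = 1" for u k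
    using step.lower[of u k] step.upper[of k u] that by (simp_all add: step.eq_inner)
  have bdd: "bdd_above ((\<lambda>z. inner z (W k z)) ` {z. norm z = 1})"
    "bdd_below ((\<lambda>z. inner z (W k z)) ` {z. norm z = 1})" for k
    using quad by (auto intro: bdd_aboveI2[of _ _ \<mu>] bdd_belowI2[of _ \<nu>])
  have unit: "N k \<le> inner u (W k u)" "inner u (W k u) \<le> M k" if "norm u = 1" for u k
    unfolding M_def N_def using that bdd by (auto intro: cSUP_upper cINF_lower)
  have N: "\<nu> \<le> N k" for k
    unfolding N_def using True quad by (intro cINF_greatest) auto
  have NM: "N k \<le> M k" for k using True unit[of _ k] order_trans by blast
  have SN: "N k * (norm u)\<^sup>2 \<le> S k u u \<and> S k u u \<le> M k * (norm u)\<^sup>2" for u k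
  proof (cases "u = 0")
    case False
    define v where "v = u /\<^sub>R norm u"
    have v: "norm v = 1" and u: "u = norm u *\<^sub>R v" using False by (simp_all add: v_def)
    have "S k u u = (norm u)\<^sup>2 * S k v v"
      by (subst (1 2) u) (simp add: step.scale_left step.scale_right power2_eq_square)
    then show ?thesis
      using mult_left_mono[OF unit(1)[OF v, of k], of "(norm u)\<^sup>2"]
        mult_left_mono[OF unit(2)[OF v, of k], of "(norm u)\<^sup>2"]
      by (simp add: step.eq_inner mult.commute)
  qed (use step.lower[of 0 k] step.upper[of k 0] in simp)
  obtain \<epsilon> E where \<epsilon>: "\<And>k. 0 \<le> \<epsilon> k" "\<And>k. (\<Sum>i<k. \<epsilon> i) \<le> (E::real)"
    and fejer: "\<And>k. S k (x (Suc k) - z) (x (Suc k) - z) \<le> S k (x k - z) (x k - z) + \<epsilon> k"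
    using quasi_fejer by metis
  define \<eta> where "\<eta> k = (M k - N k) / \<nu>" for k
  define b where "b k = (norm (x k - z))\<^sup>2" for k
  have \<eta>: "0 \<le> \<eta> k" for k using NM[of k] \<nu>_pos by (simp add: \<eta>_def)
  have "summable \<eta>"
    unfolding \<eta>_def using summable by (intro summable_divide) (simp add: M_def N_def)
  have "b (Suc k) \<le> (1 + \<eta> k) * (b k + \<epsilon> k / \<nu>)" for k
  proof -
    have "N k * b (Suc k) \<le> M k * b k + \<epsilon> k"
      using SN[of k "x (Suc k) - z"] SN[of k "x k - z"] fejer[of k] unfolding b_def by linarith
    moreover have "M k = N k + \<nu> * \<eta> k" using \<nu>_pos by (simp add: \<eta>_def)
    \<comment> \<open>\<open>\<nu> \<le> N k\<close> makes \<open>N k\<close> a common factor of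
      both error terms, so that it can be divided out.\<close>
    moreover have "\<nu> * \<eta> k * b k \<le> N k * \<eta> k * b k"
      using N[of k] \<eta>[of k] by (intro mult_right_mono) (auto simp: b_def)
    moreover have "\<epsilon> k \<le> N k * (\<epsilon> k / \<nu>)"
      using N[of k] \<nu>_pos \<epsilon>(1)[of k] mult_right_mono[of \<nu> "N k" "\<epsilon> k / \<nu>"] by simp
    ultimately have "N k * b (Suc k) \<le> N k * ((1 + \<eta> k) * b k + \<epsilon> k / \<nu>)"
      by (simp add: algebra_simps)
    then have "b (Suc k) \<le> (1 + \<eta> k) * b k + \<epsilon> k / \<nu>"
      using N[of k] \<nu>_pos by simp
    also have "\<dots> \<le> (1 + \<eta> k) * (b k + \<epsilon> k / \<nu>)"
      using mult_nonneg_nonneg[OF \<eta>[of k], of "\<epsilon> k / \<nu>"] \<epsilon>(1)[of k] \<nu>_pos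
      by (simp add: distrib_left distrib_right add_divide_distrib)
    finally show ?thesis .
  qed
  moreover have "0 \<le> \<epsilon> k / \<nu>" "(\<Sum>i<k. \<epsilon> i / \<nu>) \<le> E / \<nu>" for k
    using \<epsilon> \<nu>_pos by (auto simp: sum_divide_distrib[symmetric] divide_right_mono)
  ultimately have "b k \<le> exp (suminf \<eta>) * (b 0 + E / \<nu>)" for k
    using \<eta> \<open>summable \<eta>\<close> by (intro quasi_fejer_bounded[where \<epsilon> = "\<lambda>k. \<epsilon> k / \<nu>"]) (auto simp: b_def)
  then show ?thesis unfolding b_def by blast
qed

text \<open>Bounded sublevel sets of \<open>g\<close> are weakly compact, so the gradient is Lipschitz on them. One such
  set contains the iterates; the resulting bound on the gradients yields a second one that
  contains all trial points.\<close>

lemma trial_points: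
  assumes lip: "\<And>K. K \<subseteq> edom g \<Longrightarrow> compactin weak_topology K \<Longrightarrow> \<exists>L. L-lipschitz_on K G"
    and bd: "\<exists>B. \<forall>k. (norm (x k - z))\<^sup>2 \<le> B"
  obtains K L where "convex K" "K \<subseteq> edom g" "L-lipschitz_on K G" "\<And>k. x k \<in> K"
    "\<And>k c. 0 < c \<Longrightarrow> c \<le> \<Gamma> \<Longrightarrow> fb_point f g (S k) (W k) (x k) c \<in> K"
proof -
  define sub where "sub c R = {u. g u \<le> ereal c} \<inter> cball 0 R" for c R
  have sub_dom: "sub c R \<subseteq> edom g" for c R by (auto simp: sub_def edom_def intro: le_less_trans)
  have mem_sub: "u \<in> sub c R \<longleftrightarrow> u \<in> edom g \<and> gr u \<le> c \<and> norm u \<le> R" for u c R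
  proof (cases "u \<in> edom g")
    case True
    then show ?thesis using g_real[OF True] by (cases "g u") (auto simp: sub_def)
  qed (use sub_dom in blast)
  have sub_convex: "convex (sub c R)" for c R
  proof (rule convexI)
    fix u v and s t :: real
    assume uv: "u \<in> sub c R" "v \<in> sub c R" and t: "0 \<le> s" "0 \<le> t" "s + t = 1"
    then have s: "s = 1 - t" by simp
    have "gr (s *\<^sub>R u + t *\<^sub>R v) \<le> (1 - t) * gr u + t * gr v" "s *\<^sub>R u + t *\<^sub>R v \<in> edom g"
      using convex_on_real[OF g(1,2), of u v t] uv t by (auto simp: s mem_sub)
    moreover have "(1 - t) * gr u + t * gr v \<le> c"
      using uv t by (intro convex_bound_le) (auto simp: mem_sub)
    moreover have "s *\<^sub>R u + t *\<^sub>R v \<in> cball 0 R"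
      using uv t by (intro convexD[OF convex_cball]) (auto simp: mem_sub)
    ultimately show "s *\<^sub>R u + t *\<^sub>R v \<in> sub c R" by (auto simp: mem_sub)
  qed
  have sub_lip: "\<exists>L. L-lipschitz_on (sub c R) G" for c R
  proof (intro lip sub_dom compactin_weak_topology sub_convex)
    show "closed (sub c R)" unfolding sub_def by (intro closed_Int lsc_closed_sublevel g closed_cball)
    show "bounded (sub c R)" unfolding sub_def by (intro bounded_Int) simp
  qed
  obtain B where B: "\<And>k. (norm (x k - z))\<^sup>2 \<le> B" using bd by blast
  define R where "R = sqrt B + norm z"
  have R: "norm (x k) \<le> R" for k
    using real_sqrt_le_mono[OF B[of k]] norm_triangle_ineq[of "x k - z" z] by (simp add: R_def)
  \<comment> \<open>Since \<open>obj\<close> decreases, a lower bound for \<open>f\<close> bounds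
    \<open>g\<close> from above; it comes from the affine minorant of \<open>f\<close> at
    \<open>x 0\<close>, over distances at most \<open>2 * R\<close>.\<close>
  define c0 where "c0 = obj (x 0) - fr (x 0) + 2 * R * norm (G (x 0))"
  have gx: "gr (x k) \<le> c0" for k
  proof -
    have "- inner (x k - x 0) (G (x 0)) \<le> norm (x k - x 0) * norm (G (x 0))"
      using Cauchy_Schwarz_ineq2[of "x k - x 0" "G (x 0)"] by linarith
    also have "\<dots> \<le> (2 * R) * norm (G (x 0))"
      using norm_triangle_ineq4[of "x k" "x 0"] R[of k] R[of 0] by (intro mult_right_mono) auto
    finally show ?thesis
      using gradient_inequality[OF x_edom[of 0], of "x k"] x_edom[of k] dom obj_le[of k]
      by (auto simp: c0_def)
  qed
  have x0: "x k \<in> sub c0 R" for k using gx R x_edom by (simp add: mem_sub)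
  obtain L0 where L0: "L0-lipschitz_on (sub c0 R) G" using sub_lip by blast
  define G0 where "G0 = norm (G (x 0)) + L0 * (2 * R)"
  have G0: "norm (G (x k)) \<le> G0" for k
  proof -
    have "norm (G (x k)) \<le> norm (G (x 0)) + dist (G (x k)) (G (x 0))" by (simp add: dist_norm norm_triangle_sub)
    also have "dist (G (x k)) (G (x 0)) \<le> L0 * dist (x k) (x 0)" by (rule lipschitz_onD[OF L0 x0 x0])
    also have "\<dots> \<le> L0 * (2 * R)"
      using norm_triangle_ineq4[of "x k" "x 0"] R[of k] R[of 0] lipschitz_on_nonneg[OF L0]
      by (intro mult_left_mono) (auto simp: dist_norm)
    finally show ?thesis by (simp add: G0_def)
  qed
  then have G0_nonneg: "0 \<le> G0" using norm_ge_zero order_trans by blast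
  obtain a b where ab: "0 \<le> b" "\<And>u. u \<in> edom g \<Longrightarrow> a - b * norm u \<le> gr u"
    using proper_convex_lsc_minorant[OF g(1,2) lsc_closed_sublevel[OF g(3)]] by blast
  \<comment> \<open>Bounds \<open>c0\<close> minus the affine minorant of \<open>g\<close> at radius
    \<open>R\<close>; the absolute value only secures nonnegativity.\<close>
  define A where "A = \<bar>c0 - a + b * R\<bar>"
  \<comment> \<open>Solves \<open>key\<close>: for \<open>s > 1\<close> dividing by \<open>s\<close>
    gives \<open>\<nu> * s \<le> \<Gamma> * (A + b + G0)\<close>, and the summand 1 covers
    \<open>s \<le> 1\<close>.\<close>
  define D where "D = 1 + \<Gamma> * (A + b + G0) / \<nu>"
  have trial: "fb_point f g (S k) (W k) (x k) c \<in> sub (c0 + G0 * D) (R + D)" if c: "0 < c" "c \<le> \<Gamma>" for k c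
  proof -
    define p where "p = fb_point f g (S k) (W k) (x k) c"
    define s where "s = norm (p - x k)"
    have p: "p \<in> edom g" using step.fb_point(1)[OF c(1) x_edom] by (simp add: p_def)
    define m where "m = gr p - gr (x k) + inner (p - x k) (G (x k))"
    have dec: "S k (p - x k) (p - x k) \<le> - c * m"
      using step.model_decrease[OF x_edom c(1)] by (simp add: p_def m_def)
    have ip: "- inner (p - x k) (G (x k)) \<le> G0 * s"
    proof -
      have "- inner (p - x k) (G (x k)) \<le> norm (p - x k) * norm (G (x k))"
        using Cauchy_Schwarz_ineq2[of "p - x k" "G (x k)"] by linarith
      also have "\<dots> \<le> s * G0" unfolding s_def by (intro mult_left_mono G0) simp
      finally show ?thesis by (simp add: mult.commute)
    qed
    have np: "norm p \<le> R + s" using norm_triangle_ineq[of "x k" "p - x k"] R[of k] by (simp add: s_def)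
    then have "b * norm p \<le> b * (R + s)" using ab(1) by (intro mult_left_mono)
    then have "- m \<le> A + (b + G0) * s"
      using ab(2)[OF p] gx[of k] ip unfolding m_def A_def by (simp add: distrib_left distrib_right)
    moreover have nn: "0 \<le> A + (b + G0) * s"
      using ab(1) G0_nonneg by (simp add: A_def s_def)
    ultimately have "c * (- m) \<le> \<Gamma> * (A + (b + G0) * s)"
      using c by (meson mult_left_mono mult_right_mono less_imp_le order_trans)
    then have key: "\<nu> * s\<^sup>2 \<le> \<Gamma> * (A + (b + G0) * s)"
      using step.lower[of "p - x k" k] dec by (simp add: s_def)
    have sD: "s \<le> D"
    proof (cases "s \<le> 1")
      case True
      moreover have "0 \<le> \<Gamma> * (A + b + G0) / \<nu>"
        using \<Gamma>_pos \<nu>_pos ab(1) G0_nonneg by (simp add: A_def)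
      ultimately show ?thesis by (simp add: D_def)
    next
      case False
      have "A \<le> A * s" using False by (simp add: A_def mult_le_cancel_left1)
      then have "A + (b + G0) * s \<le> (A + b + G0) * s" by (simp add: algebra_simps)
      then have "\<Gamma> * (A + (b + G0) * s) \<le> \<Gamma> * (A + b + G0) * s"
        using \<Gamma>_pos by (simp add: mult.assoc)
      then have "\<nu> * s * s \<le> \<Gamma> * (A + b + G0) * s" using key by (simp add: power2_eq_square)
      then have "\<nu> * s \<le> \<Gamma> * (A + b + G0)" using False by simp
      then show ?thesis using \<nu>_pos by (simp add: D_def field_simps)
    qed
    have "0 \<le> c * (- m)" using order_trans[OF step.nonneg dec] by simp
    \<comment> \<open>Nonpositivity of the predicted change leaves only the gradient term, at most
      \<open>G0 * D\<close>, for \<open>g\<close> to grow by.\<close>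
    then have "m \<le> 0" using c by (simp add: zero_le_mult_iff mult_le_0_iff)
    moreover have "G0 * s \<le> G0 * D" using G0_nonneg sD by (rule mult_left_mono[rotated])
    ultimately have "gr p \<le> c0 + G0 * D" using gx[of k] ip by (simp add: m_def)
    then show ?thesis using p np sD by (simp add: mem_sub p_def)
  qed
  have "0 \<le> \<Gamma> * (A + b + G0) / \<nu>"
    using \<Gamma>_pos \<nu>_pos ab(1) G0_nonneg by (simp add: A_def)
  then have "0 \<le> D" by (simp add: D_def)
  then have "x k \<in> sub (c0 + G0 * D) (R + D)" for k
    using x0[of k] G0_nonneg by (auto simp: mem_sub intro: add_increasing2)
  with sub_lip sub_dom sub_convex trial that show thesis by meson
qed

end

end

theorem proposition3p24:
  fixes f g :: "'a::{real_inner,complete_space} \<Rightarrow> ereal"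
    and S :: "nat \<Rightarrow> 'a \<Rightarrow> 'a \<Rightarrow> real"
    and W :: "nat \<Rightarrow> 'a \<Rightarrow> 'a"
    and \<nu> \<mu> \<delta> \<theta> gambar lambar :: real
    and x y :: "nat \<Rightarrow> 'a"
    and \<gamma> lam :: "nat \<Rightarrow> real"
  assumes "proper f" and "ext_convex f" and "lsc f"
    and "proper g" and "ext_convex g" and "lsc g"
    and "edom g \<subseteq> edom f"
    and "gateaux_differentiable_on f (edom g)"
    and "\<And>k. is_scalar_product (S k)"
    and "\<And>k. associated_operator (S k) (W k)"
    and "0 < \<nu>" and "\<nu> \<le> \<mu>"
    and "\<And>k z. \<nu> * (norm z)\<^sup>2 \<le> (sp_norm (S k) z)\<^sup>2"
    and "\<And>k z. (sp_norm (S k) z)\<^sup>2 \<le> \<mu> * (norm z)\<^sup>2"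
    and "(\<exists>\<eta> :: nat \<Rightarrow> real. (\<forall>k. 0 \<le> \<eta> k) \<and> summable \<eta> \<and>
            (\<forall>k z. (sp_norm (S (Suc k)) z)\<^sup>2 \<le> (1 + \<eta> k) * (sp_norm (S k) z)\<^sup>2))
         \<or> summable (\<lambda>k. (SUP z\<in>{z. norm z = 1}. inner z (W k z))
                          - (INF z\<in>{z. norm z = 1}. inner z (W k z)))"
    and "0 < \<delta>" and "\<delta> < 1" and "0 < \<theta>" and "\<theta> < 1"
    and "vm_fbs f g S W x y \<gamma> lam"
  shows
    "(\<forall>L::real. L-lipschitz_on (edom g) (gateaux_gradient f) \<longrightarrow>
        (LS1 f g S W \<delta> \<theta> gambar x \<gamma> lam \<longrightarrow>
           (INF k. ereal (\<gamma> k)) \<ge>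
             min (ereal gambar) (ereal (2 * \<delta> * \<theta> * \<nu>) / (ereal L * (SUP k. ereal (lam k))))) \<and>
        (LS2 f g S W \<delta> \<theta> lambar x \<gamma> lam \<or> LS3 f g S W \<delta> \<theta> lambar x y \<gamma> lam \<longrightarrow>
           (INF k. ereal (lam k)) \<ge>
             min (ereal lambar) (ereal (2 * \<delta> * \<theta> * \<nu>) / (ereal L * (SUP k. ereal (\<gamma> k))))) \<and>
        (LS4 f g S W \<delta> \<theta> gambar x \<gamma> lam \<longrightarrow>
           (INF k. ereal (\<gamma> k)) \<ge>
             min (ereal gambar) (ereal (\<delta> * \<theta> * \<nu>) / (ereal L * (SUP k. ereal (lam k))))))
     \<and>
     ((\<exists>z. is_arg_min (\<lambda>z. f z + g z) (\<lambda>_. True) z) \<and>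
      (\<forall>K. K \<subseteq> edom g \<and> compactin weak_topology K \<longrightarrow>
         (\<exists>L. L-lipschitz_on K (gateaux_gradient f))) \<and>
      (LS1 f g S W \<delta> \<theta> gambar x \<gamma> lam \<or> LS2 f g S W \<delta> \<theta> lambar x \<gamma> lam \<or>
       LS3 f g S W \<delta> \<theta> lambar x y \<gamma> lam \<or> LS4 f g S W \<delta> \<theta> gambar x \<gamma> lam) \<longrightarrow>
        0 < (INF k. ereal (\<gamma> k)) \<and> 0 < (INF k. ereal (lam k)))"
proof -
  interpret vm_fbs_run f g S W x y \<gamma> lam \<nu> \<mu> \<delta> \<theta>
  proof (intro vm_fbs_run.intro vm_fbs_run_axioms.intro)
    show "fb_problem f g" by (intro fb_problem.intro assms(1,2,4-8))
    fix k
    \<comment> \<open>Needed to undo the square root in \<open>sp_norm\<close>, so that the norm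
      bounds become bounds on \<open>S k z z\<close>.\<close>
    have nonneg: "0 \<le> S k z z" for z
    proof (cases "z = 0")
      case True
      then show ?thesis
        using assms(9)[of k] by (simp add: is_scalar_product_def bilinear_lzero)
    qed (use assms(9)[of k] in \<open>auto simp: is_scalar_product_def less_imp_le\<close>)
    show "scalar_metric (S k) (W k) \<nu> \<mu>"
      using assms(9,10,11) assms(13)[of _ k] assms(14)[of k] nonneg
      by unfold_locales (simp_all add: sp_norm_def)
  qed (use assms in auto)
  have lam_fin: "(SUP k. ereal (lam k)) < \<infinity>"
  proof (rule le_less_trans)
    show "(SUP k. ereal (lam k)) \<le> ereal 1" using params by (intro SUP_least) simp
  qed simp
  have C: "0 < \<delta> * \<theta> * \<nu>" "0 < 2 * \<delta> * \<theta> * \<nu>" using assms by simp_all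
  have fb_edom: "fb_point f g (S k) (W k) (x k) c \<in> edom g" if "0 < c" for k c
    using step.fb_point(1)[OF that x_edom] .
  \<comment> \<open>Kept general in \<open>K\<close>, which is \<open>edom g\<close> in the first
    claim and the sublevel set of \<open>trial_points\<close> in the second.\<close>
  have bound1: "min (ereal gambar) (ereal (2 * \<delta> * \<theta> * \<nu>) / (ereal L * (SUP k. ereal (lam k)))) \<le> (INF k. ereal (\<gamma> k))"
    if "LS1 f g S W \<delta> \<theta> gambar x \<gamma> lam"
      and K: "convex K" "K \<subseteq> edom g" "L-lipschitz_on K G" "\<And>k. x k \<in> K"
      and trial: "\<And>k c. 0 < c \<Longrightarrow> c \<le> gambar \<Longrightarrow> fb_point f g (S k) (W k) (x k) c \<in> K" for K L
    by (rule min_le_INF[OF LS1_lower_bound[OF K that(1) trial] params(2) lam_fin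
          lipschitz_on_nonneg[OF K(3)] C(2)])
  have bound4: "min (ereal gambar) (ereal (\<delta> * \<theta> * \<nu>) / (ereal L * (SUP k. ereal (lam k)))) \<le> (INF k. ereal (\<gamma> k))"
    if "LS4 f g S W \<delta> \<theta> gambar x \<gamma> lam"
      and K: "convex K" "K \<subseteq> edom g" "L-lipschitz_on K G" "\<And>k. x k \<in> K"
      and trial: "\<And>k c. 0 < c \<Longrightarrow> c \<le> gambar \<Longrightarrow> fb_point f g (S k) (W k) (x k) c \<in> K" for K L
    by (rule min_le_INF[OF LS4_lower_bound[OF K that(1) trial] params(2) lam_fin
          lipschitz_on_nonneg[OF K(3)] C(1)])
  have \<gamma>_fin: "(SUP k. ereal (\<gamma> k)) < \<infinity>"
    if "LS2 f g S W \<delta> \<theta> lambar x \<gamma> lam \<or> LS3 f g S W \<delta> \<theta> lambar x y \<gamma> lam"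
    using that by (auto simp: LS2_def LS3_def)
  have bound23: "min (ereal lambar) (ereal (2 * \<delta> * \<theta> * \<nu>) / (ereal L * (SUP k. ereal (\<gamma> k)))) \<le> (INF k. ereal (lam k))"
    if LS: "LS2 f g S W \<delta> \<theta> lambar x \<gamma> lam \<or> LS3 f g S W \<delta> \<theta> lambar x y \<gamma> lam"
      and K: "convex K" "K \<subseteq> edom g" "L-lipschitz_on K G" "\<And>k. x k \<in> K"
      and trial: "\<And>k. y k \<in> K" for K L
    by (rule min_le_INF[OF LS2_LS3_lower_bound[OF K LS trial] params(1) \<gamma>_fin[OF LS]
          lipschitz_on_nonneg[OF K(3)] C(2)])
  have part1: "(LS1 f g S W \<delta> \<theta> gambar x \<gamma> lam \<longrightarrow>
           (INF k. ereal (\<gamma> k)) \<ge>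
             min (ereal gambar) (ereal (2 * \<delta> * \<theta> * \<nu>) / (ereal L * (SUP k. ereal (lam k))))) \<and>
        (LS2 f g S W \<delta> \<theta> lambar x \<gamma> lam \<or> LS3 f g S W \<delta> \<theta> lambar x y \<gamma> lam \<longrightarrow>
           (INF k. ereal (lam k)) \<ge>
             min (ereal lambar) (ereal (2 * \<delta> * \<theta> * \<nu>) / (ereal L * (SUP k. ereal (\<gamma> k))))) \<and>
        (LS4 f g S W \<delta> \<theta> gambar x \<gamma> lam \<longrightarrow>
           (INF k. ereal (\<gamma> k)) \<ge>
             min (ereal gambar) (ereal (\<delta> * \<theta> * \<nu>) / (ereal L * (SUP k. ereal (lam k)))))"
    if "L-lipschitz_on (edom g) G" for L
    using bound1[OF _ step.convex_edom order_refl that x_edom fb_edom]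
      bound4[OF _ step.convex_edom order_refl that x_edom fb_edom]
      bound23[OF _ step.convex_edom order_refl that x_edom] fb_edom[OF params(1)]
    by (simp add: y_eq)
  have part2: "0 < (INF k. ereal (\<gamma> k)) \<and> 0 < (INF k. ereal (lam k))"
    if z: "is_arg_min (\<lambda>z. f z + g z) (\<lambda>_. True) z"
      and lip: "\<And>K. K \<subseteq> edom g \<Longrightarrow> compactin weak_topology K \<Longrightarrow> \<exists>L. L-lipschitz_on K G"
      and LS: "LS1 f g S W \<delta> \<theta> gambar x \<gamma> lam \<or> LS2 f g S W \<delta> \<theta> lambar x \<gamma> lam \<or>
       LS3 f g S W \<delta> \<theta> lambar x y \<gamma> lam \<or> LS4 f g S W \<delta> \<theta> gambar x \<gamma> lam" for z
  proof -
    have armijo: "step.armijo_test k \<delta> (\<gamma> k) (lam k) (x k)" for k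
      using LS LS1_backtracking(1) LS2_backtracking(1) LS3_backtracking(1) LS4_backtracking(1)
        step.quadratic_imp_armijo[OF x_edom params] step.gradient_imp_quadratic[OF x_edom params]
        assms(16) by (meson less_imp_le)
    \<comment> \<open>The bound \<open>\<Gamma>\<close> on the prox parameters is left open: it is
      \<open>gambar\<close> for LS1 and LS4, and the supremum of the given \<open>\<gamma>\<close>
      for LS2 and LS3.\<close>
    have all: thesis
      if \<Gamma>: "\<And>k. \<gamma> k \<le> \<Gamma>"
        and *: "\<And>K L. convex K \<Longrightarrow> K \<subseteq> edom g \<Longrightarrow> L-lipschitz_on K G \<Longrightarrow> (\<And>k. x k \<in> K) \<Longrightarrow>
          (\<And>k c. 0 < c \<Longrightarrow> c \<le> \<Gamma> \<Longrightarrow> fb_point f g (S k) (W k) (x k) c \<in> K) \<Longrightarrow> thesis"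
      for \<Gamma> thesis
    proof -
      have "\<exists>B. \<forall>k. (norm (x k - z))\<^sup>2 \<le> B"
        using assms(15)
      proof
        assume "\<exists>\<eta> :: nat \<Rightarrow> real. (\<forall>k. 0 \<le> \<eta> k) \<and> summable \<eta> \<and>
            (\<forall>k z. (sp_norm (S (Suc k)) z)\<^sup>2 \<le> (1 + \<eta> k) * (sp_norm (S k) z)\<^sup>2)"
        then show ?thesis using bounded_if_almost_monotone[OF z armijo \<Gamma>] by blast
      qed (rule bounded_if_almost_scalar[OF z armijo \<Gamma>])
      from trial_points[OF z armijo \<Gamma> lip this] * show thesis by metis
    qed
    from LS consider (1) "LS1 f g S W \<delta> \<theta> gambar x \<gamma> lam"
      | (23) "LS2 f g S W \<delta> \<theta> lambar x \<gamma> lam \<or> LS3 f g S W \<delta> \<theta> lambar x y \<gamma> lam"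
      | (4) "LS4 f g S W \<delta> \<theta> gambar x \<gamma> lam" by blast
    then show ?thesis
    proof cases
      case 1
      then have "0 < gambar" "0 < (INF k. ereal (lam k))" by (auto simp: LS1_def)
      moreover have "0 < (INF k. ereal (\<gamma> k))"
      proof (rule all[OF LS1_backtracking(2)[OF 1]])
        fix K L assume K: "convex K" "K \<subseteq> edom g" "L-lipschitz_on K G" "\<And>k. x k \<in> K"
          "\<And>k c. 0 < c \<Longrightarrow> c \<le> gambar \<Longrightarrow> fb_point f g (S k) (W k) (x k) c \<in> K"
        show ?thesis
          by (rule less_le_trans[OF min_quotient_pos[OF params(2) lam_fin
                lipschitz_on_nonneg[OF K(3)] C(2) \<open>0 < gambar\<close>] bound1[OF 1 K]])
      qed
      ultimately show ?thesis by blast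
    next
      case 4
      then have "0 < gambar" "0 < (INF k. ereal (lam k))" by (auto simp: LS4_def)
      moreover have "0 < (INF k. ereal (\<gamma> k))"
      proof (rule all[OF LS4_backtracking(2)[OF 4]])
        fix K L assume K: "convex K" "K \<subseteq> edom g" "L-lipschitz_on K G" "\<And>k. x k \<in> K"
          "\<And>k c. 0 < c \<Longrightarrow> c \<le> gambar \<Longrightarrow> fb_point f g (S k) (W k) (x k) c \<in> K"
        show ?thesis
          by (rule less_le_trans[OF min_quotient_pos[OF params(2) lam_fin
                lipschitz_on_nonneg[OF K(3)] C(1) \<open>0 < gambar\<close>] bound4[OF 4 K]])
      qed
      ultimately show ?thesis by blast
    next
      case 23
      then have lambar: "0 < lambar" and "0 < (INF k. ereal (\<gamma> k))" by (auto simp: LS2_def LS3_def)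
      obtain \<Gamma> where "(SUP k. ereal (\<gamma> k)) = ereal \<Gamma>"
        using \<gamma>_fin[OF 23] SUP_upper[of 0 UNIV "\<lambda>k. ereal (\<gamma> k)"]
        by (cases "SUP k. ereal (\<gamma> k)") auto
      then have \<Gamma>: "\<gamma> k \<le> \<Gamma>" for k
        using SUP_upper[of k UNIV "\<lambda>k. ereal (\<gamma> k)"] by simp
      have "0 < (INF k. ereal (lam k))"
      proof (rule all[OF \<Gamma>])
        fix K L assume K: "convex K" "K \<subseteq> edom g" "L-lipschitz_on K G" "\<And>k. x k \<in> K"
          "\<And>k c. 0 < c \<Longrightarrow> c \<le> \<Gamma> \<Longrightarrow> fb_point f g (S k) (W k) (x k) c \<in> K"
        have "y k \<in> K" for k unfolding y_eq by (rule K(5)[OF params(1) \<Gamma>])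
        show ?thesis
          by (rule less_le_trans[OF min_quotient_pos[OF params(1) \<gamma>_fin[OF 23]
                lipschitz_on_nonneg[OF K(3)] C(2) lambar] bound23[OF 23 K(1-4) \<open>\<And>k. y k \<in> K\<close>]])
      qed
      with \<open>0 < (INF k. ereal (\<gamma> k))\<close> show ?thesis by blast
    qed
  qed
  show ?thesis
    by (intro conjI allI part1 impI) (use part1 part2 in blast)+
qed

end
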